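(* Let $((X^n(t))_{t\in[0,T]})_{n\in\mathbb{N}}$ be a family of $p$-dimensional, continuous, centered Gaussian processes, starting from zero, with independent components, which satisfies an LDP on $C([0,T],\mathbb{R}^p)$ with speed $\gamma_n$ and good rate function $$I(h)=\sum_{i=1}^p I_i(h_i),\qquad I_i(h_i)=\begin{cases}\frac12\|h_i\|^2_{\mathscr{H}_i} & h_i\in\mathscr{H}_i\\ +\infty & h_i\notin\mathscr{H}_i,\end{cases}$$ where $\mathscr{H}_i\subset C([0,T],\mathbb{R})$ is the reproducing kernel Hilbert space associated to some covariance function $k_{ii}$. Let $A^n=(\widetilde A^n_1,\ldots,\widetilde A^n_p)$, $n\in\mathbb{N}$, be independent of $(X^n)_{n\in\mathbb{N}}$, where each of $(\widetilde A^n_1)_{n\in\mathbb{N}},\ldots,(\widetilde A^n_p)_{n\in\mathbb{N}}$ is a family of positive random variables satisfying the LDP on $[0,+\infty)$ with speed $\gamma_n$ and the same good rate function $x\mapsto dx^\theta$ ($x\ge0$), for some $d>0$ and $\theta>2$. Let $\hat b=(\hat b_1,\ldots,\hat b_p)\in C([0,T],\mathbb{R}^p)$ and $$Z^n(t)=A^n\circ X^n(t)+\hat b(t)\quad(t\in[0,T]),$$ where $u\circ v=(u_1v_1,\ldots,u_pv_p)$. Let $0\ne\xi\in\mathbb{R}^p$ with $\xi_i\ge0$ for $i=1,\ldots,p$, and let $x>0$ be such that $x-\langle\hat b(t),\xi\rangle>0$ for every $t\in[0,T]$. Set $$p_n:=\mathbb{P}\Big(\sup_{t\in[0,T]}\langle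 Z^n(t),\xi\rangle\ge x\Big).$$ Then $$\lim_{n\to+\infty}\frac1{\gamma_n}\log(p_n)=-w_H^{(\bot)},$$ $$w_H^{(\bot)}:=\psi(d,\theta)\inf_{t\in[0,T]}\left[\frac12\,\frac{(-\langle\hat b(t),\xi\rangle+x)^2}{\Big(\sum_{j=1}^p\xi_j^{2\theta/(\theta-2)}k_{jj}(t,t)^{\theta/(\theta-2)}\Big)^{(\theta-2)/\theta}}\right]^{\theta/(\theta+2)}.$$
   Context: $T>0$ and $p\ge1$ are fixed; $\langle\cdot,\cdot\rangle$ is the Euclidean inner product on $\mathbb{R}^p$; $C([0,T],\mathbb{R}^p)$ carries the sup-norm. For $d,\theta>0$, $$\psi(d,\theta):=2^{\theta/(\theta+2)}\Big(d(d\theta)^{-\theta/(\theta+2)}+\frac12(d\theta)^{2/(\theta+2)}\Big).$$ Quotients with positive numerator and zero denominator (e.g. at $t=0$, where $k_{ii}(0,0)=0$) are read as $+\infty$; a positive power of $+\infty$ is $+\infty$; $\log 0=-\infty$. Large deviation principle (LDP): let $E$ be a topological space with Borel $\sigma$-algebra and $\gamma_n>0$ with $\gamma_n\to+\infty$ (the speed). A rate function is a lower semicontinuous $I:E\to[0,+\infty]$; it is good if $\{I\le a\}$ is compact for all $a\ge0$. Probability measures $(\mu_n)$ satisfy the LDP on $E$ with rate function $I$ and speed $\gamma_n$ if $\liminf_n\frac1{\gamma_n}\log\mu_n(\Theta)\ge-\inf_{x\in\Theta}I(x)$ for every open $\Theta$ and $\limsup_n\frac1{\gamma_n}\log\mu_n(\Gamma)\le-\inf_{x\in\Gamma}I(x)$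 for every closed $\Gamma$. Random elements satisfy an LDP if their laws do. Reproducing kernel Hilbert space (RKHS): let $U=(U(t))_{t\in[0,T]}$ be a real continuous centered Gaussian process with covariance function $k$. Let $H$ be the $L^2$-closure of $\{\int_0^TU(t)\,d\lambda(t):\lambda\text{ a signed measure on }[0,T]\}$. The RKHS of $k$ is $\mathscr{H}=\{h: h(t)=\mathbb{E}[U(t)Y],\ Y\in H\}\subset C([0,T],\mathbb{R})$, with inner product transported from $L^2$ by the bijection $Y\mapsto\mathbb{E}[U(\cdot)Y]$. Equivalently it is the completion of the functions $x(t)=\int_0^Tk(t,s)\,d\lambda(s)$ under $\|x\|^2=\int_0^T\int_0^Tk(t,s)\,d\lambda(t)\,d\lambda(s)$.
   Formalization: The formal theorem additionally assumes that, for each n, the components of A^n are mutually independent; without this the claim fails, e.g. for p=2 with both components of A^n equal, ξ=(1,1), zero b̂ and X^n two independent scaled Brownian motions. *)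

theory Defs
  imports "HOL-Probability.Probability"
begin

definition ereal_log :: "real \<Rightarrow> ereal" where
  "ereal_log x = (if x = 0 then -\<infinity> else ereal (ln x))"

text \<open>Real powers on \<open>[0,\<infinity>]\<close>; only positive exponents are used.  Note that \<^typ>\<open>ereal\<close>
  division already satisfies \<open>a / 0 = \<infinity>\<close> for \<open>a > 0\<close>.\<close>

definition ereal_powr :: "ereal \<Rightarrow> real \<Rightarrow> ereal" where
  "ereal_powr x r = (if x = \<infinity> then \<infinity> else ereal (real_of_ereal x powr r))"

definition borel_of :: "'e topology \<Rightarrow> 'e measure" where
  "borel_of E = sigma (topspace E) {U. openin E U}"

definition rate_function :: "'e topology \<Rightarrow> ('e \<Rightarrow> ereal) \<Rightarrow> bool" where
  "rate_function E I \<longleftrightarrow>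
     (\<forall>x\<in>topspace E. 0 \<le> I x) \<and> (\<forall>a. openin E {x \<in> topspace E. a < I x})"

definition good_rate_function :: "'e topology \<Rightarrow> ('e \<Rightarrow> ereal) \<Rightarrow> bool" where
  "good_rate_function E I \<longleftrightarrow>
     rate_function E I \<and> (\<forall>a\<ge>0. compactin E {x \<in> topspace E. I x \<le> ereal a})"

definition speed :: "(nat \<Rightarrow> real) \<Rightarrow> bool" where
  "speed \<gamma> \<longleftrightarrow> (\<forall>n. \<gamma> n > 0) \<and> filterlim \<gamma> at_top sequentially"

definition satisfies_LDP ::
    "'e topology \<Rightarrow> (nat \<Rightarrow> 'e measure) \<Rightarrow> ('e \<Rightarrow> ereal) \<Rightarrow> (nat \<Rightarrow> real) \<Rightarrow> bool" where
  "satisfies_LDP E \<mu> I \<gamma> \<longleftrightarrow>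
     speed \<gamma> \<and> rate_function E I \<and>
     (\<forall>n. prob_space (\<mu> n) \<and> sets (\<mu> n) = sets (borel_of E)) \<and>
     (\<forall>G. openin E G \<longrightarrow>
        liminf (\<lambda>n. ereal (1 / \<gamma> n) * ereal_log (measure (\<mu> n) G)) \<ge> - (INF x\<in>G. I x)) \<and>
     (\<forall>F. closedin E F \<longrightarrow>
        limsup (\<lambda>n. ereal (1 / \<gamma> n) * ereal_log (measure (\<mu> n) F)) \<le> - (INF x\<in>F. I x))"

definition satisfies_LDP_rv ::
    "'e topology \<Rightarrow> 'a measure \<Rightarrow> (nat \<Rightarrow> 'a \<Rightarrow> 'e) \<Rightarrow> ('e \<Rightarrow> ereal) \<Rightarrow> (nat \<Rightarrow> real) \<Rightarrow> bool" where
  "satisfies_LDP_rv E M Y I \<gamma> \<longleftrightarrow> satisfies_LDP E (\<lambda>n. distr M (borel_of E) (Y n)) I \<gamma>"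

text \<open>The space \<open>C([0,T], 'b)\<close> with the topology of the sup-norm; its points are the continuous
  functions on \<open>[0,T]\<close>, extended by \<^const>\<open>undefined\<close> outside.\<close>

definition C_space :: "real \<Rightarrow> (real \<Rightarrow> 'b::real_normed_vector) topology" where
  "C_space T = mtopology_of (cfunspace (top_of_set {0..T}) euclidean_metric)"

text \<open>The degenerate Gaussian law (the point mass at 0) is included.\<close>

definition centered_gaussian :: "'a measure \<Rightarrow> ('a \<Rightarrow> real) \<Rightarrow> bool" where
  "centered_gaussian M Y \<longleftrightarrow>
     Y \<in> borel_measurable M \<and>
     ((AE \<omega> in M. Y \<omega> = 0) \<or> (\<exists>\<sigma>>0. distributed M lborel Y (normal_density 0 \<sigma>)))"

definition continuous_centered_gaussian_process ::
    "'a measure \<Rightarrow> real \<Rightarrow> (real \<Rightarrow> 'a \<Rightarrow> 'b::euclidean_space) \<Rightarrow> bool" where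
  "continuous_centered_gaussian_process M T V \<longleftrightarrow>
     (\<forall>t\<in>{0..T}. V t \<in> borel_measurable M) \<and>
     (\<forall>\<omega>\<in>space M. continuous_on {0..T} (\<lambda>t. V t \<omega>)) \<and>
     (\<forall>F c. finite F \<and> F \<subseteq> {0..T} \<longrightarrow> centered_gaussian M (\<lambda>\<omega>. \<Sum>t\<in>F. c t \<bullet> V t \<omega>))"

definition is_covariance_of ::
    "(real \<Rightarrow> real \<Rightarrow> real) \<Rightarrow> 'a measure \<Rightarrow> real \<Rightarrow> (real \<Rightarrow> 'a \<Rightarrow> real) \<Rightarrow> bool" where
  "is_covariance_of k M T U \<longleftrightarrow>
     (\<forall>s\<in>{0..T}. \<forall>t\<in>{0..T}. k s t = (\<integral>\<omega>. U s \<omega> * U t \<omega> \<partial>M))"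

definition finite_measure_on :: "real \<Rightarrow> real measure \<Rightarrow> bool" where
  "finite_measure_on T \<mu> \<longleftrightarrow>
     finite_measure \<mu> \<and> sets \<mu> = sets (restrict_space borel {0..T})"

text \<open>Signed measures are represented by their Jordan decompositions, as differences
  \<open>\<mu> - \<nu>\<close> of two finite measures.\<close>

definition signed_integral ::
    "real measure \<Rightarrow> real measure \<Rightarrow> (real \<Rightarrow> 'a \<Rightarrow> real) \<Rightarrow> 'a \<Rightarrow> real" where
  "signed_integral \<mu> \<nu> U \<omega> = (\<integral>t. U t \<omega> \<partial>\<mu>) - (\<integral>t. U t \<omega> \<partial>\<nu>)"

text \<open>The \<open>L\<^sup>2\<close>-closure of the variables \<open>\<integral> U d(\<mu> - \<nu>)\<close>; its elements are square integrable
  functions rather than their equivalence classes modulo null sets.\<close>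

definition gaussian_H :: "'a measure \<Rightarrow> real \<Rightarrow> (real \<Rightarrow> 'a \<Rightarrow> real) \<Rightarrow> ('a \<Rightarrow> real) set" where
  "gaussian_H M T U =
     {Y \<in> borel_measurable M. integrable M (\<lambda>\<omega>. (Y \<omega>)\<^sup>2) \<and>
        (\<forall>\<epsilon>>0. \<exists>\<mu> \<nu>. finite_measure_on T \<mu> \<and> finite_measure_on T \<nu> \<and>
           (\<integral>\<omega>. (Y \<omega> - signed_integral \<mu> \<nu> U \<omega>)\<^sup>2 \<partial>M) < \<epsilon>)}"

definition rkhs_map :: "'a measure \<Rightarrow> real \<Rightarrow> (real \<Rightarrow> 'a \<Rightarrow> real) \<Rightarrow> ('a \<Rightarrow> real) \<Rightarrow> real \<Rightarrow> real" where
  "rkhs_map M T U Y = (\<lambda>t\<in>{0..T}. \<integral>\<omega>. U t \<omega> * Y \<omega> \<partial>M)"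

text \<open>The RKHS of the covariance function of \<open>U\<close>.  It depends on \<open>U\<close> only through that
  covariance function.\<close>

definition rkhs :: "'a measure \<Rightarrow> real \<Rightarrow> (real \<Rightarrow> 'a \<Rightarrow> real) \<Rightarrow> (real \<Rightarrow> real) set" where
  "rkhs M T U = rkhs_map M T U ` gaussian_H M T U"

text \<open>The norm transported from \<open>L\<^sup>2\<close>: \<^const>\<open>rkhs_map\<close> is injective on \<^const>\<open>gaussian_H\<close> up to
  almost sure equality, so the value is unique for \<open>h\<close> in the RKHS.\<close>

definition rkhs_norm :: "'a measure \<Rightarrow> real \<Rightarrow> (real \<Rightarrow> 'a \<Rightarrow> real) \<Rightarrow> (real \<Rightarrow> real) \<Rightarrow> real" where
  "rkhs_norm M T U h =
     (THE r. \<exists>Y\<in>gaussian_H M T U. rkhs_map M T U Y = h \<and> r = sqrt (\<integral>\<omega>. (Y \<omega>)\<^sup>2 \<partial>M))"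

definition gaussian_rate ::
    "'a measure \<Rightarrow> real \<Rightarrow> (real \<Rightarrow> 'a \<Rightarrow> real) \<Rightarrow> (real \<Rightarrow> real) \<Rightarrow> ereal" where
  "gaussian_rate M T U h =
     (if h \<in> rkhs M T U then ereal (1/2 * (rkhs_norm M T U h)\<^sup>2) else \<infinity>)"

definition \<psi> :: "real \<Rightarrow> real \<Rightarrow> real" where
  "\<psi> d \<theta> = 2 powr (\<theta> / (\<theta> + 2)) *
     (d * (d * \<theta>) powr (- \<theta> / (\<theta> + 2)) + 1/2 * (d * \<theta>) powr (2 / (\<theta> + 2)))"

definition w_H_perp ::
    "real \<Rightarrow> real \<Rightarrow> real \<Rightarrow> ('p::finite \<Rightarrow> real \<Rightarrow> real \<Rightarrow> real) \<Rightarrow> (real \<Rightarrow> real^'p) \<Rightarrow>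
       real^'p \<Rightarrow> real \<Rightarrow> ereal" where
  "w_H_perp T d \<theta> k b \<xi> x =
     ereal (\<psi> d \<theta>) *
     (INF t\<in>{0..T}. ereal_powr
        (ereal (1/2) *
          (ereal ((- (b t \<bullet> \<xi>) + x)\<^sup>2) /
           ereal ((\<Sum>j\<in>UNIV. (\<xi> $ j) powr (2 * \<theta> / (\<theta> - 2)) * (k j t t) powr (\<theta> / (\<theta> - 2)))
                    powr ((\<theta> - 2) / \<theta>))))
        (\<theta> / (\<theta> + 2)))"

end

theory Submission
  imports Defs
begin

text \<open>
  Fix \<open>t\<close>, put \<open>c = x - b t \<bullet> \<xi>\<close>, \<open>v j = k j t t\<close>, and ask what it costs that the level is exceeded
  at time \<open>t\<close>, that is, that \<open>A n\<close> is near some \<open>a\<close> and \<open>X n\<close> near some \<open>h\<close> with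
  \<open>\<Sum>i. a i * \<xi> i * h i t \<ge> c\<close>.  By independence the cost is \<open>d * (\<Sum>i. a i powr \<theta>) + \<Sum>i. J i\<close>,
  where \<open>J i\<close> is half the squared RKHS norm of \<open>h i\<close>.  Evaluation at \<open>t\<close> is represented in the RKHS by
  the kernel section \<open>k i \<sqdot> t\<close>, so \<open>(h i t)\<^sup>2 \<le> 2 * J i * v i\<close>.  The Cauchy-Schwarz inequality, Hoelder's
  inequality with the exponents \<open>\<theta> / 2\<close> and \<open>\<theta> / (\<theta> - 2)\<close>, and the weighted inequality between arithmetic
  and geometric mean then bound the cost from below by \<open>\<psi> d \<theta> * (c\<^sup>2 / (2 * S)) powr (\<theta> / (\<theta> + 2))\<close>,
  where \<open>S\<close> is the \<open>\<theta> / (\<theta> - 2)\<close>-norm of the vector \<open>\<xi> j\<^sup>2 * v j\<close> (\<open>cost_lower_bound\<close>).  All these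
  inequalities are equalities for suitable multiples of kernel sections and suitable \<open>a\<close>
  (\<open>cost_attained\<close>).  The infimum of these costs over \<open>t\<close> is the claimed rate.

  The cost becomes an exponential rate without a large deviation principle for the pair \<open>(A n, X n)\<close>.
  For the upper bound (\<open>exceedance_upper\<close>), the values of \<open>A n\<close> in a large cube are distributed over a
  fine finite grid.  Because \<open>\<xi>\<close> and \<open>A n\<close> are nonnegative, exceedance within a cell implies that
  \<open>\<Sum>i. u i * \<xi> i * \<bar>X n t i\<bar> \<ge> c\<close> at some \<open>t\<close>, where \<open>u\<close> is the upper corner of the cell; this is a
  closed event for \<open>X n\<close> alone, independent of the event that \<open>A n\<close> lies in the cell.  The cost at the
  upper corner is controlled, and the cell has the cost of its lower corner, which is almost the same.
  Finitely many cells and the tails of \<open>A n\<close> do not change the exponential rate.  For the lower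
  bound (\<open>exceedance_lower\<close>), near a minimiser for a slightly higher level an open box for \<open>A n\<close> and an
  open condition on \<open>X n t\<close> force exceedance.

  The rate function of \<open>X n\<close> is evaluated through the Gaussian Hilbert space.  The RKHS norm is
  meaningful since a square integrable variable orthogonal to every \<open>U t\<close> is orthogonal to every
  \<open>\<integral>U d\<lambda>\<close> by Fubini's theorem and hence to their \<open>L\<^sup>2\<close>-closure (\<open>orthogonal_to_H\<close>).  Fubini's theorem
  asks for bounded variances, and membership of kernel sections in the path space asks for their
  continuity.  Both come from the \<open>L\<^sup>2\<close>-continuity of \<open>U\<close>, which path continuity gives thanks to a
  small ball estimate (\<open>centered_gaussian_small_ball\<close>): a centered Gaussian variable with standard
  deviation \<open>\<sigma>\<close> gives mass at most \<open>e / \<sigma>\<close> to \<open>[-e, e]\<close>, so that convergence in probability forces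
  the standard deviations to tend to zero.
\<close>

section \<open>The finite-dimensional optimisation problem\<close>

text \<open>Young's inequality, applied to the two families after each is divided by its norm.\<close>

lemma Hoelder_inequality_sum:
  fixes f g :: "'i \<Rightarrow> real"
  assumes "finite I" and "p > 1" "q > 1" "1 / p + 1 / q = 1"
    and f: "\<And>i. i \<in> I \<Longrightarrow> 0 \<le> f i" and g: "\<And>i. i \<in> I \<Longrightarrow> 0 \<le> g i"
  shows "(\<Sum>i\<in>I. f i * g i)
    \<le> (\<Sum>i\<in>I. f i powr p) powr (1 / p) * (\<Sum>i\<in>I. g i powr q) powr (1 / q)"
proof -
  define F where "F = (\<Sum>i\<in>I. f i powr p)"
  define G where "G = (\<Sum>i\<in>I. g i powr q)"
  have "F \<ge> 0" "G \<ge> 0" by (auto simp: F_def G_def sum_nonneg)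
  show ?thesis
  proof (cases "F = 0 \<or> G = 0")
    case True
    then have "f i * g i = 0" if "i \<in> I" for i
      using that \<open>finite I\<close> by (auto simp: F_def G_def sum_nonneg_eq_0_iff)
    then have "(\<Sum>i\<in>I. f i * g i) = 0" by (simp add: sum.neutral)
    then show ?thesis by simp
  next
    case False
    with \<open>F \<ge> 0\<close> \<open>G \<ge> 0\<close> have "F > 0" "G > 0" by auto
    define f' where "f' = (\<lambda>i. f i / F powr (1/p))"
    define g' where "g' = (\<lambda>i. g i / G powr (1/q))"
    have f': "f' i powr p = f i powr p / F" and g': "g' i powr q = g i powr q / G"
      if "i \<in> I" for i
      using \<open>F > 0\<close> \<open>G > 0\<close> f[OF that] g[OF that] \<open>p > 1\<close> \<open>q > 1\<close>
      by (simp_all add: f'_def g'_def powr_divide powr_powr)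
    have "(\<Sum>i\<in>I. f' i * g' i) \<le> (\<Sum>i\<in>I. f' i powr p / p + g' i powr q / q)"
      using assms by (intro sum_mono Youngs_inequality) (auto simp: f'_def g'_def)
    also have "\<dots> = (\<Sum>i\<in>I. f i powr p / F / p + g i powr q / G / q)"
      by (intro sum.cong) (simp_all add: f' g')
    also have "\<dots> = F / F / p + G / G / q"
      by (simp only: sum.distrib sum_divide_distrib[symmetric] F_def[symmetric] G_def[symmetric])
    also have "\<dots> = 1" using \<open>F > 0\<close> \<open>G > 0\<close> assms(4) by simp
    finally have *: "(\<Sum>i\<in>I. f' i * g' i) \<le> 1" .
    have "(\<Sum>i\<in>I. f i * g i) = (F powr (1/p) * G powr (1/q)) * (\<Sum>i\<in>I. f' i * g' i)"
      unfolding sum_distrib_left f'_def g'_def using \<open>F > 0\<close> \<open>G > 0\<close>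
      by (intro sum.cong) (auto simp: field_simps)
    also have "\<dots> \<le> (F powr (1/p) * G powr (1/q)) * 1"
      using * by (intro mult_left_mono) auto
    finally show ?thesis by (simp add: F_def G_def)
  qed
qed

text \<open>The factor \<open>(d * \<theta>) powr (2 / (\<theta> + 2))\<close> in the definition of \<^const>\<open>\<psi>\<close> is
  \<open>d * \<theta> * (d * \<theta>) powr (- \<theta> / (\<theta> + 2))\<close>; so both summands are multiples of one power.\<close>

lemma \<psi>_alt:
  assumes "d > 0" "\<theta> > 2"
  shows "\<psi> d \<theta> = (\<theta> + 2) * (d / 2) * (2 / (d * \<theta>)) powr (\<theta> / (\<theta> + 2))"
proof -
  have "2 / (\<theta> + 2) = 1 + - (\<theta> / (\<theta> + 2))"
    using assms by (simp add: field_simps)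
  then have "(d * \<theta>) powr (2 / (\<theta> + 2)) = (d * \<theta>) * (d * \<theta>) powr - (\<theta> / (\<theta> + 2))"
    using assms by (simp only: powr_add) simp
  then show ?thesis
    using assms unfolding \<psi>_def
    by (simp add: powr_divide powr_minus algebra_simps divide_simps)
qed

lemma \<psi>_pos: "d > 0 \<Longrightarrow> \<theta> > 2 \<Longrightarrow> \<psi> d \<theta> > 0"
  by (simp add: \<psi>_alt)

text \<open>Here \<open>P\<close> stands for \<open>\<Sum>i. a i powr \<theta>\<close> and \<open>B * P powr (- 2 / \<theta>)\<close> for the least cost of a path
  that reaches the level when it is scaled by such an \<open>a\<close>.  The weights \<open>2 / (\<theta> + 2)\<close> and \<open>\<theta> / (\<theta> + 2)\<close>
  are those for which \<open>P\<close> cancels from the weighted geometric mean.\<close>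

lemma \<psi>_lower_bound:
  assumes "d > 0" "\<theta> > 2" "B > 0" "P > 0"
  shows "\<psi> d \<theta> * B powr (\<theta> / (\<theta> + 2)) \<le> d * P + B * P powr (- 2 / \<theta>)"
proof -
  define \<alpha> where "\<alpha> = 2 / (\<theta> + 2)"
  define \<beta> where "\<beta> = \<theta> / (\<theta> + 2)"
  have "\<alpha> + \<beta> = (2 + \<theta>) / (\<theta> + 2)" unfolding \<alpha>_def \<beta>_def by (rule add_divide_distrib[symmetric])
  also have "\<dots> = 1" using assms by simp
  finally have ab: "\<alpha> > 0" "\<beta> > 0" "\<alpha> + \<beta> = 1" "\<alpha> = 1 + - \<beta>"
    using assms by (auto simp: \<alpha>_def \<beta>_def)
  have "(d * P / \<alpha>) powr \<alpha> * (B * P powr (- 2 / \<theta>) / \<beta>) powr \<beta>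
      \<le> \<alpha> * (d * P / \<alpha>) + \<beta> * (B * P powr (- 2 / \<theta>) / \<beta>)"
    using assms ab by (intro Youngs_inequality_0) auto
  also have "\<dots> = d * P + B * P powr (- 2 / \<theta>)" using ab by simp
  also have "(d * P / \<alpha>) powr \<alpha> * (B * P powr (- 2 / \<theta>) / \<beta>) powr \<beta>
      = ((d / \<alpha>) powr \<alpha> * (1 / \<beta>) powr \<beta>) * B powr \<beta> * (P powr \<alpha> * P powr (- 2 / \<theta> * \<beta>))"
    using assms ab by (simp add: powr_mult powr_divide powr_powr)
  also have "P powr \<alpha> * P powr (- 2 / \<theta> * \<beta>) = 1"
  proof -
    have "\<alpha> + - 2 / \<theta> * \<beta> = 0" using assms by (simp add: \<alpha>_def \<beta>_def field_simps)
    then show ?thesis using assms by (simp flip: powr_add)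
  qed
  also have "(d / \<alpha>) powr \<alpha> * (1 / \<beta>) powr \<beta> = \<psi> d \<theta>"
  proof -
    have "(d / \<alpha>) powr \<alpha> = (d / \<alpha>) * (d / \<alpha>) powr - \<beta>"
      unfolding \<open>\<alpha> = 1 + - \<beta>\<close> using assms ab
      by (simp only: powr_add) simp
    moreover have "(d / \<alpha>) powr - \<beta> * (1 / \<beta>) powr \<beta> = (2 / (d * \<theta>)) powr \<beta>"
    proof -
      have "(d / \<alpha>) powr - \<beta> = (\<alpha> / d) powr \<beta>"
        using assms ab by (simp add: powr_minus powr_divide)
      moreover have "\<alpha> / d * (1 / \<beta>) = 2 / (d * \<theta>)"
        using assms add_pos_pos[of \<theta> 2] by (simp add: \<alpha>_def \<beta>_def divide_simps)
      ultimately show ?thesis using assms ab by (simp flip: powr_mult)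
    qed
    moreover have "d / \<alpha> = (\<theta> + 2) * (d / 2)" by (simp add: \<alpha>_def)
    ultimately have "(d / \<alpha>) powr \<alpha> * (1 / \<beta>) powr \<beta>
        = (\<theta> + 2) * (d / 2) * (2 / (d * \<theta>)) powr \<beta>"
      by (metis mult.assoc)
    then show ?thesis using assms(1,2) by (simp only: \<psi>_alt \<beta>_def[symmetric])
  qed
  finally show ?thesis by (simp add: \<beta>_def)
qed

text \<open>The derivative of \<open>d * r powr \<theta> + B / r\<^sup>2\<close> vanishes at this \<open>r\<close>, and the bound of
  \<open>\<psi>_lower_bound\<close> is attained there with \<open>P = r powr \<theta>\<close>.\<close>

lemma \<psi>_attained:
  assumes "d > 0" "\<theta> > 2" "B > 0"
  defines "r \<equiv> (2 * B / (d * \<theta>)) powr (1 / (\<theta> + 2))"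
  shows "d * r powr \<theta> + B / r\<^sup>2 = \<psi> d \<theta> * B powr (\<theta> / (\<theta> + 2))"
proof -
  define R where "R = 2 * B / (d * \<theta>)"
  define \<beta> where "\<beta> = \<theta> / (\<theta> + 2)"
  have "R > 0" using assms by (simp add: R_def)
  moreover have r_R: "r = R powr (1 / (\<theta> + 2))" by (simp add: r_def R_def)
  ultimately have "r > 0" by simp
  have r\<theta>: "r powr \<theta> = R powr \<beta>"
    by (simp add: r_R powr_powr \<beta>_def)
  have "r powr (\<theta> + 2) = R"
    using \<open>\<theta> > 2\<close> \<open>R > 0\<close> by (simp add: r_R powr_powr)
  then have "R powr \<beta> * r\<^sup>2 = R"
    using \<open>r > 0\<close> by (simp add: powr_add r\<theta>)
  then have "B / r\<^sup>2 = B * R powr \<beta> / R"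
    using \<open>R > 0\<close> \<open>r > 0\<close> by (metis mult_divide_mult_cancel_left powr_gt_zero less_irrefl mult.commute)
  then have "d * r powr \<theta> + B / r\<^sup>2 = R powr \<beta> * (d + B / R)"
    by (simp add: r\<theta> algebra_simps)
  also have "d + B / R = (\<theta> + 2) * (d / 2)"
    using assms by (simp add: R_def field_simps)
  also have "R powr \<beta> = (2 / (d * \<theta>)) powr \<beta> * B powr \<beta>"
    unfolding R_def using assms by (simp add: powr_mult[symmetric])
  finally show ?thesis using assms by (simp add: \<psi>_alt \<beta>_def)
qed

text \<open>For \<open>\<theta> > 2\<close> and nonnegative \<open>\<xi>\<close> and \<open>v\<close> this is, by Hoelder duality, the maximum of the variance \<open>\<Sum>j. (a j * \<xi> j)\<^sup>2 * v j\<close> over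
  all \<open>a \<ge> 0\<close> with \<open>\<Sum>j. a j powr \<theta> = 1\<close>.\<close>

definition dual_variance :: "real \<Rightarrow> real^'p \<Rightarrow> ('p::finite \<Rightarrow> real) \<Rightarrow> real" where
  "dual_variance \<theta> \<xi> v = (\<Sum>j\<in>UNIV. (\<xi> $ j) powr (2 * \<theta> / (\<theta> - 2)) * v j powr (\<theta> / (\<theta> - 2)))
                    powr ((\<theta> - 2) / \<theta>)"

lemma dual_variance_eq:
  assumes "\<theta> > 2" "\<And>i. \<xi> $ i \<ge> 0" "\<And>i. v i \<ge> 0"
  shows "dual_variance \<theta> \<xi> v = (\<Sum>j\<in>UNIV. ((\<xi> $ j)\<^sup>2 * v j) powr (\<theta> / (\<theta> - 2))) powr ((\<theta> - 2) / \<theta>)"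
proof -
  have "(\<xi> $ j) powr (2 * \<theta> / (\<theta> - 2)) = ((\<xi> $ j)\<^sup>2) powr (\<theta> / (\<theta> - 2))" for j
    using assms(1) assms(2)[of j]
    by (cases "\<xi> $ j = 0") (simp_all add: powr_powr flip: powr_numeral)
  then show ?thesis using assms by (simp add: dual_variance_def powr_mult)
qed

text \<open>The level \<open>c\<close> is reached only if \<open>c\<^sup>2 \<le> 2 * (\<Sum>i. J i) * (\<Sum>i. (a i * \<xi> i)\<^sup>2 * v i)\<close>, by the Cauchy-Schwarz
  inequality; Hoelder's inequality separates \<open>a\<close> from the variances, and \<open>\<psi>_lower_bound\<close> removes \<open>a\<close>.
  The vector \<open>\<eta>\<close> stands for the values at one time of the components of a path with costs \<open>J\<close>.\<close>

lemma cost_lower_bound: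
  fixes \<xi> :: "real^'p::finite"
  assumes "d > 0" "\<theta> > 2" "c > 0"
    and nn: "\<And>i. \<xi> $ i \<ge> 0" "\<And>i. v i \<ge> 0" "\<And>i. a i \<ge> 0" "\<And>i. J i \<ge> 0"
    and \<eta>: "\<And>i. (\<eta> i)\<^sup>2 \<le> 2 * J i * v i"
    and reach: "c \<le> (\<Sum>i\<in>UNIV. a i * (\<xi> $ i) * \<eta> i)"
  shows "dual_variance \<theta> \<xi> v > 0"
    and "\<psi> d \<theta> * (1/2 * (c\<^sup>2 / dual_variance \<theta> \<xi> v)) powr (\<theta> / (\<theta> + 2))
      \<le> d * (\<Sum>i\<in>UNIV. a i powr \<theta>) + (\<Sum>i\<in>UNIV. J i)"
proof -
  define S where "S = dual_variance \<theta> \<xi> v"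
  define P where "P = (\<Sum>i\<in>UNIV. a i powr \<theta>)"
  have "P \<ge> 0" "S \<ge> 0" by (auto simp: P_def S_def dual_variance_def sum_nonneg)
  have Jnn: "(\<Sum>i\<in>UNIV. J i) \<ge> 0" using nn by (simp add: sum_nonneg)
  have "(\<Sum>i\<in>UNIV. a i * \<xi> $ i * \<eta> i)
      \<le> (\<Sum>i\<in>UNIV. (a i * \<xi> $ i * sqrt (v i)) * sqrt (2 * J i))"
  proof (rule sum_mono)
    fix i
    have "\<eta> i \<le> sqrt (2 * J i * v i)" using \<eta>[of i] by (simp add: real_le_rsqrt)
    then have "a i * \<xi> $ i * \<eta> i \<le> a i * \<xi> $ i * sqrt (2 * J i * v i)"
      using nn by (intro mult_left_mono) auto
    then show "a i * \<xi> $ i * \<eta> i \<le> (a i * \<xi> $ i * sqrt (v i)) * sqrt (2 * J i)"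
      by (simp add: real_sqrt_mult algebra_simps)
  qed
  with reach have "c \<le> (\<Sum>i\<in>UNIV. (a i * \<xi> $ i * sqrt (v i)) * sqrt (2 * J i))" by simp
  then have "c\<^sup>2 \<le> (\<Sum>i\<in>UNIV. (a i * \<xi> $ i * sqrt (v i)) * sqrt (2 * J i))\<^sup>2"
    using \<open>c > 0\<close> by (intro power_mono) auto
  also have "\<dots> \<le> (\<Sum>i\<in>UNIV. (a i * \<xi> $ i * sqrt (v i))\<^sup>2) * (\<Sum>i\<in>UNIV. (sqrt (2 * J i))\<^sup>2)"
    by (rule Cauchy_Schwarz_ineq_sum)
  also have "\<dots> = (\<Sum>i\<in>UNIV. (a i)\<^sup>2 * ((\<xi> $ i)\<^sup>2 * v i)) * (2 * (\<Sum>i\<in>UNIV. J i))"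
    using nn by (simp add: power_mult_distrib sum_distrib_left mult.assoc)
  also have "\<dots> \<le> (P powr (2 / \<theta>) * S) * (2 * (\<Sum>i\<in>UNIV. J i))"
  proof (rule mult_right_mono)
    have "(\<Sum>i\<in>UNIV. (a i)\<^sup>2 * ((\<xi> $ i)\<^sup>2 * v i))
      \<le> (\<Sum>i\<in>UNIV. (a i)\<^sup>2 powr (\<theta> / 2)) powr (1 / (\<theta> / 2)) *
        (\<Sum>i\<in>UNIV. ((\<xi> $ i)\<^sup>2 * v i) powr (\<theta> / (\<theta> - 2))) powr (1 / (\<theta> / (\<theta> - 2)))"
      using \<open>\<theta> > 2\<close> nn by (intro Hoelder_inequality_sum) (auto simp: field_simps)
    also have "(\<Sum>i\<in>UNIV. (a i)\<^sup>2 powr (\<theta> / 2)) = P"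
      unfolding P_def
    proof (intro sum.cong refl)
      fix i show "(a i)\<^sup>2 powr (\<theta> / 2) = a i powr \<theta>"
        using nn(3)[of i] \<open>\<theta> > 2\<close>
        by (cases "a i = 0") (simp_all add: powr_powr flip: powr_numeral)
    qed
    finally show "(\<Sum>i\<in>UNIV. (a i)\<^sup>2 * ((\<xi> $ i)\<^sup>2 * v i)) \<le> P powr (2 / \<theta>) * S"
      using assms by (simp add: S_def dual_variance_eq)
  qed (use Jnn in simp)
  finally have main: "c\<^sup>2 \<le> 2 * (P powr (2 / \<theta>) * S * (\<Sum>i\<in>UNIV. J i))"
    by (simp add: algebra_simps)
  have "c\<^sup>2 > 0" using \<open>c > 0\<close> by simp
  with main have "P powr (2 / \<theta>) * S * (\<Sum>i\<in>UNIV. J i) \<noteq> 0" by auto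
  then have pos: "P > 0" "S > 0" using \<open>P \<ge> 0\<close> \<open>S \<ge> 0\<close> by auto
  then show "dual_variance \<theta> \<xi> v > 0" by (simp add: S_def)
  define B where "B = 1/2 * (c\<^sup>2 / S)"
  have "B > 0" using pos \<open>c > 0\<close> by (simp add: B_def)
  have "B * P powr (- 2 / \<theta>) \<le> (\<Sum>i\<in>UNIV. J i)"
    using main pos unfolding B_def by (simp add: powr_minus field_simps)
  with \<psi>_lower_bound[OF assms(1,2) \<open>B > 0\<close> \<open>P > 0\<close>]
  show "\<psi> d \<theta> * (1/2 * (c\<^sup>2 / dual_variance \<theta> \<xi> v)) powr (\<theta> / (\<theta> + 2))
      \<le> d * (\<Sum>i\<in>UNIV. a i powr \<theta>) + (\<Sum>i\<in>UNIV. J i)"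
    by (simp add: B_def S_def P_def)
qed

text \<open>The direction of \<open>a\<close> is the case of equality in Hoelder's inequality, \<open>l\<close> is the case of equality
  in the Cauchy-Schwarz inequality, and the length \<open>r\<close> of \<open>a\<close> is that of \<open>\<psi>_attained\<close>.  The number
  \<open>l i * v i\<close> is the value at \<open>t\<close> of the path \<open>l i * k i \<sqdot> t\<close>, whose cost is \<open>1/2 * (l i)\<^sup>2 * v i\<close>.\<close>

lemma cost_attained:
  fixes \<xi> :: "real^'p::finite"
  assumes "d > 0" "\<theta> > 2" "c > 0"
    and nn: "\<And>i. \<xi> $ i \<ge> 0" "\<And>i. v i \<ge> 0"
    and S: "dual_variance \<theta> \<xi> v > 0"
  obtains a l :: "'p \<Rightarrow> real" where "\<And>i. a i \<ge> 0"
    and "(\<Sum>i\<in>UNIV. a i * (\<xi> $ i) * (l i * v i)) = c"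
    and "d * (\<Sum>i\<in>UNIV. a i powr \<theta>) + (\<Sum>i\<in>UNIV. 1/2 * (l i)\<^sup>2 * v i)
      = \<psi> d \<theta> * (1/2 * (c\<^sup>2 / dual_variance \<theta> \<xi> v)) powr (\<theta> / (\<theta> + 2))"
proof -
  define S where "S = dual_variance \<theta> \<xi> v"
  define w where "w = (\<lambda>i. (\<xi> $ i)\<^sup>2 * v i)"
  have w: "w i \<ge> 0" for i using nn by (simp add: w_def)
  define Q where "Q = (\<Sum>i\<in>UNIV. w i powr (\<theta> / (\<theta> - 2)))"
  have SQ: "S = Q powr ((\<theta> - 2) / \<theta>)"
    using assms by (simp add: S_def Q_def w_def dual_variance_eq)
  have "S > 0" using S by (simp add: S_def)
  have "Q \<ge> 0" by (simp add: Q_def sum_nonneg)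
  with \<open>S > 0\<close> have "Q > 0" by (auto simp: SQ)
  define B where "B = 1/2 * (c\<^sup>2 / S)"
  have "B > 0" using \<open>c > 0\<close> \<open>S > 0\<close> by (simp add: B_def)
  define r where "r = (2 * B / (d * \<theta>)) powr (1 / (\<theta> + 2))"
  have "r > 0" using assms \<open>B > 0\<close> by (simp add: r_def)
  define a where "a = (\<lambda>i. r * Q powr (- 1 / \<theta>) * w i powr (1 / (\<theta> - 2)))"
  define l where "l = (\<lambda>i. c / (r\<^sup>2 * S) * (a i * \<xi> $ i))"
  have a: "a i \<ge> 0" for i using \<open>r > 0\<close> by (simp add: a_def)
  have "(Q powr (- 1 / \<theta>)) powr \<theta> = 1 / Q"
    using \<open>\<theta> > 2\<close> \<open>Q > 0\<close> by (simp only: powr_powr) (simp add: powr_minus_divide)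
  then have "(\<Sum>i\<in>UNIV. a i powr \<theta>) = (\<Sum>i\<in>UNIV. r powr \<theta> / Q * w i powr (\<theta> / (\<theta> - 2)))"
    using \<open>r > 0\<close> \<open>Q > 0\<close> \<open>\<theta> > 2\<close>
    by (intro sum.cong refl) (simp add: a_def powr_mult, simp add: powr_powr)
  also have "\<dots> = r powr \<theta>"
    unfolding sum_distrib_left[symmetric] Q_def[symmetric] using \<open>Q > 0\<close> by simp
  finally have a\<theta>: "(\<Sum>i\<in>UNIV. a i powr \<theta>) = r powr \<theta>" .
  have "(a i)\<^sup>2 * w i = r\<^sup>2 * Q powr (- 2 / \<theta>) * w i powr (\<theta> / (\<theta> - 2))" for i
  proof (cases "w i = 0")
    case False
    then have "w i > 0" using w[of i] by simp
    have "(a i)\<^sup>2 * w i = r\<^sup>2 * Q powr (- 2 / \<theta>) * (w i powr (2 / (\<theta> - 2)) * w i powr 1)"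
      using \<open>Q > 0\<close> \<open>w i > 0\<close>
      by (simp add: a_def power_mult_distrib powr_powr flip: powr_numeral)
    also have "w i powr (2 / (\<theta> - 2)) * w i powr 1 = w i powr (2 / (\<theta> - 2) + 1)"
      by (rule powr_add[symmetric])
    also have "2 / (\<theta> - 2) + 1 = \<theta> / (\<theta> - 2)" using \<open>\<theta> > 2\<close> by (simp add: field_simps)
    finally show ?thesis .
  qed simp
  then have "(\<Sum>i\<in>UNIV. (a i)\<^sup>2 * w i) = r\<^sup>2 * Q powr (- 2 / \<theta>) * Q"
    by (simp add: Q_def flip: sum_distrib_left)
  also have "\<dots> = r\<^sup>2 * (Q powr (- 2 / \<theta>) * Q powr 1)" using \<open>Q > 0\<close> by simp
  also have "Q powr (- 2 / \<theta>) * Q powr 1 = S"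
    unfolding SQ powr_add[symmetric] using \<open>\<theta> > 2\<close> by (simp add: field_simps)
  finally have aw: "(\<Sum>i\<in>UNIV. (a i)\<^sup>2 * w i) = r\<^sup>2 * S" .
  have 1: "(\<Sum>i\<in>UNIV. a i * (\<xi> $ i) * (l i * v i)) = c"
  proof -
    have "(\<Sum>i\<in>UNIV. a i * (\<xi> $ i) * (l i * v i)) = (\<Sum>i\<in>UNIV. c / (r\<^sup>2 * S) * ((a i)\<^sup>2 * w i))"
      by (intro sum.cong refl) (simp add: l_def w_def power2_eq_square)
    also have "\<dots> = c"
      unfolding sum_distrib_left[symmetric] aw using \<open>r > 0\<close> \<open>S > 0\<close> by simp
    finally show ?thesis .
  qed
  have "(\<Sum>i\<in>UNIV. 1/2 * (l i)\<^sup>2 * v i)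
      = (\<Sum>i\<in>UNIV. 1/2 * (c / (r\<^sup>2 * S))\<^sup>2 * ((a i)\<^sup>2 * w i))"
    by (intro sum.cong refl) (simp add: l_def w_def power_mult_distrib power_divide)
  also have "\<dots> = 1/2 * (c / (r\<^sup>2 * S))\<^sup>2 * (r\<^sup>2 * S)" by (simp only: aw flip: sum_distrib_left)
  also have "\<dots> = B / r\<^sup>2" using \<open>r > 0\<close> \<open>S > 0\<close> by (simp add: B_def power2_eq_square field_simps)
  finally have 2: "(\<Sum>i\<in>UNIV. 1/2 * (l i)\<^sup>2 * v i) = B / r\<^sup>2" .
  have "d * (\<Sum>i\<in>UNIV. a i powr \<theta>) + (\<Sum>i\<in>UNIV. 1/2 * (l i)\<^sup>2 * v i)
      = \<psi> d \<theta> * (1/2 * (c\<^sup>2 / dual_variance \<theta> \<xi> v)) powr (\<theta> / (\<theta> + 2))"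
    unfolding a\<theta> 2 using \<psi>_attained[OF assms(1,2) \<open>B > 0\<close>] by (simp add: r_def B_def S_def)
  with a 1 show thesis by (rule that)
qed

text \<open>The quantity whose infimum over \<open>t\<close> is \<^const>\<open>w_H_perp\<close>.  The factor \<open>\<psi> d \<theta>\<close> is inside, so that this is
  the cost of exceeding the level at one given time.\<close>

definition pointwise_cost :: "real \<Rightarrow> real \<Rightarrow> real^'p::finite \<Rightarrow> ('p \<Rightarrow> real) \<Rightarrow> real \<Rightarrow> ereal" where
  "pointwise_cost d \<theta> \<xi> v c = ereal (\<psi> d \<theta>) *
     ereal_powr (ereal (1/2) * (ereal (c\<^sup>2) / ereal (dual_variance \<theta> \<xi> v))) (\<theta> / (\<theta> + 2))"

lemma pointwise_cost_eq:
  assumes "d > 0" "\<theta> > 2" "c > 0"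
  shows "pointwise_cost d \<theta> \<xi> v c = (if dual_variance \<theta> \<xi> v > 0
    then ereal (\<psi> d \<theta> * (1/2 * (c\<^sup>2 / dual_variance \<theta> \<xi> v)) powr (\<theta> / (\<theta> + 2))) else \<infinity>)"
proof -
  show ?thesis
  proof (cases "dual_variance \<theta> \<xi> v > 0")
    case True
    then show ?thesis by (simp add: pointwise_cost_def ereal_powr_def)
  next
    case False
    moreover have "dual_variance \<theta> \<xi> v \<ge> 0" by (simp add: dual_variance_def)
    ultimately have "dual_variance \<theta> \<xi> v = 0" by simp
    moreover have "ereal (1/2) * (ereal (c\<^sup>2) / ereal 0) = \<infinity>" using assms by simp
    ultimately show ?thesis
      using \<psi>_pos[OF assms(1,2)] by (simp add: pointwise_cost_def ereal_powr_def del: times_divide_eq_left)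
  qed
qed

lemma w_H_perp_le_pointwise_cost:
  assumes "d > 0" "\<theta> > 2" "t \<in> {0..T}"
  shows "w_H_perp T d \<theta> k b \<xi> x \<le> pointwise_cost d \<theta> \<xi> (\<lambda>j. k j t t) (- (b t \<bullet> \<xi>) + x)"
  unfolding w_H_perp_def pointwise_cost_def dual_variance_def
  using \<psi>_pos[OF assms(1,2)] assms(3) by (intro ereal_mult_left_mono INF_lower) auto

lemma pointwise_cost_less_of_w_H_perp_less:
  assumes "d > 0" "\<theta> > 2" "w_H_perp T d \<theta> k b \<xi> x < C"
  shows "\<exists>t\<in>{0..T}. pointwise_cost d \<theta> \<xi> (\<lambda>j. k j t t) (- (b t \<bullet> \<xi>) + x) < C"
proof -
  note \<psi> = \<psi>_pos[OF assms(1,2)]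
  have "(INF t\<in>{0..T}. ereal_powr (ereal (1/2) * (ereal ((- (b t \<bullet> \<xi>) + x)\<^sup>2) /
      ereal (dual_variance \<theta> \<xi> (\<lambda>j. k j t t)))) (\<theta> / (\<theta> + 2))) < C / ereal (\<psi> d \<theta>)"
    using assms(3) \<psi>
    by (subst ereal_less_divide_pos) (simp_all add: w_H_perp_def dual_variance_def)
  then obtain t where t: "t \<in> {0..T}" and less: "ereal_powr (ereal (1/2) * (ereal ((- (b t \<bullet> \<xi>) + x)\<^sup>2) /
      ereal (dual_variance \<theta> \<xi> (\<lambda>j. k j t t)))) (\<theta> / (\<theta> + 2)) < C / ereal (\<psi> d \<theta>)"
    by (auto simp: INF_less_iff)
  have "0 < ereal (\<psi> d \<theta>)" "ereal (\<psi> d \<theta>) \<noteq> \<infinity>" using \<psi> by auto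
  from iffD1[OF ereal_less_divide_pos[OF this] less] t show ?thesis
    unfolding pointwise_cost_def by blast
qed

section \<open>Exponential rates and large deviation bounds\<close>

text \<open>Bounds on exponential rates are used in the form \<open>q n \<le> exp (- \<gamma> n * c)\<close> for all large \<open>n\<close> and all
  real \<open>c\<close> below the rate.  In this form they can be multiplied and added in the reals, and vanishing
  probabilities need no separate treatment.\<close>

lemma log_asymp_upper:
  fixes q :: "nat \<Rightarrow> real" and c :: real
  assumes \<gamma>: "speed \<gamma>" and q: "\<And>n. 0 \<le> q n"
    and lim: "limsup (\<lambda>n. ereal (1 / \<gamma> n) * ereal_log (q n)) \<le> - w" and "ereal c < w"
  shows "eventually (\<lambda>n. q n \<le> exp (- \<gamma> n * c)) sequentially"
proof -
  have "limsup (\<lambda>n. ereal (1 / \<gamma> n) * ereal_log (q n)) < - ereal c"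
    using lim \<open>ereal c < w\<close> by (meson ereal_minus_less_minus le_less_trans)
  then have "eventually (\<lambda>n. ereal (1 / \<gamma> n) * ereal_log (q n) < - ereal c) sequentially"
    by (rule Limsup_lessD)
  then show ?thesis
  proof eventually_elim
    case (elim n)
    have "\<gamma> n > 0" using \<gamma> by (simp add: speed_def)
    show ?case
    proof (cases "q n = 0")
      case False
      with q[of n] have "q n > 0" by simp
      with elim have "ln (q n) < - \<gamma> n * c"
        using \<open>\<gamma> n > 0\<close> by (simp add: ereal_log_def field_simps)
      then show ?thesis using \<open>q n > 0\<close> by (metis exp_le_cancel_iff exp_ln less_imp_le)
    qed simp
  qed
qed

lemma log_asymp_lower:
  fixes q :: "nat \<Rightarrow> real" and c :: real
  assumes \<gamma>: "speed \<gamma>" and q: "\<And>n. 0 \<le> q n"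
    and lim: "- w \<le> liminf (\<lambda>n. ereal (1 / \<gamma> n) * ereal_log (q n))" and "w < ereal c"
  shows "eventually (\<lambda>n. exp (- \<gamma> n * c) \<le> q n) sequentially"
proof -
  have "- ereal c < liminf (\<lambda>n. ereal (1 / \<gamma> n) * ereal_log (q n))"
    using lim \<open>w < ereal c\<close> by (meson ereal_minus_less_minus less_le_trans)
  then have "eventually (\<lambda>n. - ereal c < ereal (1 / \<gamma> n) * ereal_log (q n)) sequentially"
    by (rule less_LiminfD)
  then show ?thesis
  proof eventually_elim
    case (elim n)
    have "\<gamma> n > 0" using \<gamma> by (simp add: speed_def)
    have "q n \<noteq> 0"
      using elim \<open>\<gamma> n > 0\<close> by (auto simp: ereal_log_def)
    with q[of n] have "q n > 0" by simp
    with elim have "- \<gamma> n * c < ln (q n)"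
      using \<open>\<gamma> n > 0\<close> by (simp add: ereal_log_def field_simps)
    then show ?case using \<open>q n > 0\<close> by (metis exp_le_cancel_iff exp_ln less_imp_le)
  qed
qed

lemma log_asympI:
  fixes q :: "nat \<Rightarrow> real"
  assumes \<gamma>: "speed \<gamma>" and q: "\<And>n. 0 \<le> q n"
    and upper: "\<And>c. ereal c < w \<Longrightarrow> eventually (\<lambda>n. q n \<le> exp (- \<gamma> n * c)) sequentially"
    and lower: "\<And>c. w < ereal c \<Longrightarrow> eventually (\<lambda>n. exp (- \<gamma> n * c) \<le> q n) sequentially"
  shows "(\<lambda>n. ereal (1 / \<gamma> n) * ereal_log (q n)) \<longlonglongrightarrow> - w"
proof (rule order_tendstoI)
  have pos: "\<gamma> n > 0" for n using \<gamma> by (simp add: speed_def)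
  fix a assume "a < - w"
  then have "w < - a" by (simp add: ereal_less_uminus_reorder)
  then obtain c where "w < ereal c" "ereal c < - a" by (metis less_ereal.elims(2) ereal_dense2)
  from lower[OF this(1)] show "eventually (\<lambda>n. a < ereal (1 / \<gamma> n) * ereal_log (q n)) sequentially"
  proof eventually_elim
    case (elim n)
    have "q n > 0" using elim by (meson exp_gt_zero less_le_trans)
    then have "- \<gamma> n * c \<le> ln (q n)" using elim by (simp add: ln_ge_iff)
    then have "- c \<le> 1 / \<gamma> n * ln (q n)" using pos[of n] by (simp add: field_simps)
    then have "- ereal c \<le> ereal (1 / \<gamma> n) * ereal_log (q n)"
      using \<open>q n > 0\<close> by (simp add: ereal_log_def)
    moreover have "a < - ereal c" using \<open>ereal c < - a\<close> by (simp add: ereal_less_uminus_reorder)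
    ultimately show ?case by (rule less_le_trans[rotated])
  qed
next
  have pos: "\<gamma> n > 0" for n using \<gamma> by (simp add: speed_def)
  fix a assume "- w < a"
  then have "- a < w" by (simp add: ereal_uminus_less_reorder)
  then obtain c where "- a < ereal c" "ereal c < w" by (metis ereal_dense2)
  from upper[OF this(2)] show "eventually (\<lambda>n. ereal (1 / \<gamma> n) * ereal_log (q n) < a) sequentially"
  proof eventually_elim
    case (elim n)
    have ca: "- ereal c < a" using \<open>- a < ereal c\<close> by (metis ereal_uminus_less_reorder)
    show ?case
    proof (cases "q n = 0")
      case True
      then have "ereal (1 / \<gamma> n) * ereal_log (q n) = -\<infinity>"
        using pos[of n] by (simp add: ereal_log_def)
      then show ?thesis using ca by (metis ereal_infty_less(2) ereal_uminus_eq_reorder less_ereal.simps(5) less_trans uminus_ereal.simps(1))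
    next
      case False
      with q[of n] have "q n > 0" by simp
      then have "ln (q n) \<le> - \<gamma> n * c" using elim by (metis exp_le_cancel_iff exp_ln)
      then have "1 / \<gamma> n * ln (q n) \<le> - c" using pos[of n] by (simp add: field_simps)
      then have "ereal (1 / \<gamma> n) * ereal_log (q n) \<le> - ereal c"
        using \<open>q n > 0\<close> by (simp add: ereal_log_def)
      then show ?thesis using ca by (rule le_less_trans)
    qed
  qed
qed

text \<open>Since \<open>\<gamma> n\<close> tends to infinity, a constant factor is absorbed by any decrease of the exponent.\<close>

lemma exp_upper_sum:
  fixes q :: "'j \<Rightarrow> nat \<Rightarrow> real"
  assumes \<gamma>: "speed \<gamma>" and "finite J" and "c < c'"
    and q: "\<And>j. j \<in> J \<Longrightarrow> eventually (\<lambda>n. q j n \<le> exp (- \<gamma> n * c')) sequentially"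
  shows "eventually (\<lambda>n. (\<Sum>j\<in>J. q j n) \<le> exp (- \<gamma> n * c)) sequentially"
proof -
  have "eventually (\<lambda>n. ln (real (card J) + 1) / (c' - c) \<le> \<gamma> n) sequentially"
    using \<gamma> by (simp add: speed_def filterlim_at_top)
  moreover have "eventually (\<lambda>n. \<forall>j\<in>J. q j n \<le> exp (- \<gamma> n * c')) sequentially"
    using q \<open>finite J\<close> by (simp add: eventually_ball_finite)
  ultimately show ?thesis
  proof eventually_elim
    case (elim n)
    have "(\<Sum>j\<in>J. q j n) \<le> real (card J) * exp (- \<gamma> n * c')"
      using elim by (metis sum_bounded_above)
    also have "\<dots> \<le> (real (card J) + 1) * exp (- \<gamma> n * c')" by (intro mult_right_mono) auto
    also have "\<dots> = exp (ln (real (card J) + 1) - \<gamma> n * c')"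
      by (simp add: exp_diff exp_minus divide_inverse)
    also have "\<dots> \<le> exp (- \<gamma> n * c)"
      using elim(1) \<open>c < c'\<close> by (simp add: field_simps)
    finally show ?case .
  qed
qed

lemma exp_upper_prod:
  fixes q :: "'j \<Rightarrow> nat \<Rightarrow> real"
  assumes "finite J" and nn: "\<And>j n. j \<in> J \<Longrightarrow> 0 \<le> q j n"
    and q: "\<And>j. j \<in> J \<Longrightarrow> eventually (\<lambda>n. q j n \<le> exp (- \<gamma> n * c j)) sequentially"
  shows "eventually (\<lambda>n. (\<Prod>j\<in>J. q j n) \<le> exp (- \<gamma> n * (\<Sum>j\<in>J. c j))) sequentially"
proof -
  have "eventually (\<lambda>n. \<forall>j\<in>J. q j n \<le> exp (- \<gamma> n * c j)) sequentially"
    using q \<open>finite J\<close> by (simp add: eventually_ball_finite)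
  then show ?thesis
  proof eventually_elim
    case (elim n)
    then have "(\<Prod>j\<in>J. q j n) \<le> (\<Prod>j\<in>J. exp (- \<gamma> n * c j))"
      using nn by (intro prod_mono) auto
    also have "\<dots> = exp (- \<gamma> n * (\<Sum>j\<in>J. c j))"
      using \<open>finite J\<close> by (simp add: sum_distrib_left exp_sum)
    finally show ?case .
  qed
qed

lemma exp_lower_prod:
  fixes q :: "'j \<Rightarrow> nat \<Rightarrow> real"
  assumes "finite J"
    and q: "\<And>j. j \<in> J \<Longrightarrow> eventually (\<lambda>n. exp (- \<gamma> n * c j) \<le> q j n) sequentially"
  shows "eventually (\<lambda>n. exp (- \<gamma> n * (\<Sum>j\<in>J. c j)) \<le> (\<Prod>j\<in>J. q j n)) sequentially"
proof -
  have "eventually (\<lambda>n. \<forall>j\<in>J. exp (- \<gamma> n * c j) \<le> q j n) sequentially"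
    using q \<open>finite J\<close> by (simp add: eventually_ball_finite)
  then show ?thesis
  proof eventually_elim
    case (elim n)
    have "exp (- \<gamma> n * (\<Sum>j\<in>J. c j)) = (\<Prod>j\<in>J. exp (- \<gamma> n * c j))"
      using \<open>finite J\<close> by (simp add: sum_distrib_left exp_sum)
    also have "\<dots> \<le> (\<Prod>j\<in>J. q j n)" using elim by (intro prod_mono) auto
    finally show ?case .
  qed
qed

text \<open>For a map that is not measurable, \<^const>\<open>distr\<close> is still a total function.  If \<open>A\<close> has a non-measurable
  preimage, then so does its complement; both would receive mass \<open>0\<close>, against total mass \<open>1\<close>.  So a law
  that is known to be a probability measure carries the measurability of the map.\<close>

lemma prob_space_distr_measurable:
  assumes "prob_space (distr M N f)" and sp: "f \<in> space M \<rightarrow> space N"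
  shows "f \<in> measurable M N"
proof (rule ccontr)
  assume nm: "f \<notin> measurable M N"
  define \<mu> where "\<mu> = (\<lambda>A. emeasure M (f -` A \<inter> space M))"
  have D: "distr M N f = measure_of (space N) (sets N) \<mu>" by (simp add: distr_def \<mu>_def)
  interpret prob_space "distr M N f" by fact
  have 1: "emeasure (distr M N f) (space N) = 1" using emeasure_space_1 by simp
  have ms: "measure_space (space N) (sigma_sets (space N) (sets N)) \<mu>"
  proof (rule ccontr)
    assume "\<not> ?thesis"
    then have "emeasure (distr M N f) (space N) = 0"
      unfolding D by (simp add: emeasure_measure_of_conv)
    with 1 show False by simp
  qed
  have em: "emeasure (distr M N f) A = \<mu> A" if "A \<in> sets N" for A
    using that ms unfolding D by (simp add: emeasure_measure_of_conv)
  have tot: "\<mu> (space N) = 1" using em[of "space N"] 1 by simp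
  then have spM: "emeasure M (space M) = 1"
  proof -
    have "f -` space N \<inter> space M = space M" using sp by auto
    with tot show ?thesis by (simp add: \<mu>_def)
  qed
  have "f -` A \<inter> space M \<in> sets M" if A: "A \<in> sets N" for A
  proof (rule ccontr)
    assume na: "f -` A \<inter> space M \<notin> sets M"
    have "f -` (space N - A) \<inter> space M = space M - f -` A \<inter> space M" using sp by auto
    moreover have "space M - f -` A \<inter> space M \<notin> sets M"
    proof
      assume "space M - f -` A \<inter> space M \<in> sets M"
      then have "space M - (space M - f -` A \<inter> space M) \<in> sets M" by blast
      then show False using na by (simp add: double_diff)
    qed
    ultimately have "\<mu> (space N - A) = 0" "\<mu> A = 0"
      using na by (simp_all add: \<mu>_def emeasure_notin_sets)
    moreover have "emeasure (distr M N f) (space N)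
        = emeasure (distr M N f) A + emeasure (distr M N f) (space N - A)"
    proof -
      have "A \<union> (space N - A) = space N" using sets.sets_into_space[OF A] by auto
      then show ?thesis using A by (subst plus_emeasure) auto
    qed
    ultimately show False using 1 em A by simp
  qed
  then have "f \<in> measurable M N" using sp by (auto intro: measurableI)
  with nm show False by simp
qed

lemma space_borel_of [simp]: "space (borel_of E) = topspace E"
  unfolding borel_of_def by (intro space_measure_of) (auto dest: openin_subset)

lemma open_sets_borel_of: "openin E G \<Longrightarrow> G \<in> sets (borel_of E)"
  unfolding borel_of_def by (subst sets_measure_of) (auto dest: openin_subset)

lemma closed_sets_borel_of: "closedin E F \<Longrightarrow> F \<in> sets (borel_of E)"
proof -
  assume F: "closedin E F"
  then have "topspace E - F \<in> sets (borel_of E)" by (simp add: open_sets_borel_of closedin_def)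
  then have "space (borel_of E) - (topspace E - F) \<in> sets (borel_of E)" by blast
  then show ?thesis using closedin_subset[OF F] by (simp add: double_diff)
qed

lemma LDP_rv_measurable:
  assumes "satisfies_LDP_rv E M Y I \<gamma>" "\<And>\<omega>. \<omega> \<in> space M \<Longrightarrow> Y n \<omega> \<in> topspace E"
  shows "Y n \<in> measurable M (borel_of E)"
  using assms by (intro prob_space_distr_measurable) (auto simp: satisfies_LDP_rv_def satisfies_LDP_def)

text \<open>The large deviation bounds for the laws, as statements about events of the underlying space.\<close>

lemma LDP_rv_upper:
  fixes c :: real
  assumes LDP: "satisfies_LDP_rv E M Y I \<gamma>"
    and sp: "\<And>n \<omega>. \<omega> \<in> space M \<Longrightarrow> Y n \<omega> \<in> topspace E"
    and F: "closedin E F" and I: "ereal c < (INF y\<in>F. I y)"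
  shows "eventually (\<lambda>n. measure M (Y n -` F \<inter> space M) \<le> exp (- \<gamma> n * c)) sequentially"
proof (rule log_asymp_upper)
  have "measure (distr M (borel_of E) (Y n)) F = measure M (Y n -` F \<inter> space M)" for n
    using LDP sp F by (intro measure_distr LDP_rv_measurable closed_sets_borel_of) auto
  moreover have "limsup (\<lambda>n. ereal (1 / \<gamma> n) * ereal_log (measure (distr M (borel_of E) (Y n)) F))
      \<le> - (INF y\<in>F. I y)"
    using LDP F by (simp add: satisfies_LDP_rv_def satisfies_LDP_def)
  ultimately show "limsup (\<lambda>n. ereal (1 / \<gamma> n) * ereal_log (measure M (Y n -` F \<inter> space M)))
      \<le> - (INF y\<in>F. I y)" by simp
qed (use LDP I in \<open>auto simp: satisfies_LDP_rv_def satisfies_LDP_def\<close>)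

lemma LDP_rv_lower:
  fixes c :: real
  assumes LDP: "satisfies_LDP_rv E M Y I \<gamma>"
    and sp: "\<And>n \<omega>. \<omega> \<in> space M \<Longrightarrow> Y n \<omega> \<in> topspace E"
    and G: "openin E G" and I: "y \<in> G" "I y < ereal c"
  shows "eventually (\<lambda>n. exp (- \<gamma> n * c) \<le> measure M (Y n -` G \<inter> space M)) sequentially"
proof (rule log_asymp_lower)
  have "measure (distr M (borel_of E) (Y n)) G = measure M (Y n -` G \<inter> space M)" for n
    using LDP sp G by (intro measure_distr LDP_rv_measurable open_sets_borel_of) auto
  moreover have "- (INF y\<in>G. I y)
      \<le> liminf (\<lambda>n. ereal (1 / \<gamma> n) * ereal_log (measure (distr M (borel_of E) (Y n)) G))"
    using LDP G by (simp add: satisfies_LDP_rv_def satisfies_LDP_def)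
  ultimately show "- (INF y\<in>G. I y)
      \<le> liminf (\<lambda>n. ereal (1 / \<gamma> n) * ereal_log (measure M (Y n -` G \<inter> space M)))" by simp
  show "(INF y\<in>G. I y) < ereal c" using I by (meson INF_lower le_less_trans)
qed (use LDP in \<open>auto simp: satisfies_LDP_rv_def satisfies_LDP_def\<close>)

section \<open>Gaussian processes and their reproducing kernel Hilbert spaces\<close>

lemma integrable_mult_of_squares:
  fixes f g :: "'a \<Rightarrow> real"
  assumes [measurable]: "f \<in> borel_measurable M" "g \<in> borel_measurable M"
    and "integrable M (\<lambda>x. (f x)\<^sup>2)" "integrable M (\<lambda>x. (g x)\<^sup>2)"
  shows "integrable M (\<lambda>x. f x * g x)"
proof (rule Bochner_Integration.integrable_bound)
  show "integrable M (\<lambda>x. (f x)\<^sup>2 + (g x)\<^sup>2)" using assms by simp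
  show "AE x in M. norm (f x * g x) \<le> norm ((f x)\<^sup>2 + (g x)\<^sup>2)"
  proof (rule AE_I2)
    fix x
    have "0 \<le> (\<bar>f x\<bar> - \<bar>g x\<bar>)\<^sup>2" by simp
    also have "\<dots> = (f x)\<^sup>2 + (g x)\<^sup>2 - 2 * (\<bar>f x\<bar> * \<bar>g x\<bar>)" by (simp add: power2_eq_square algebra_simps)
    finally have "2 * (\<bar>f x\<bar> * \<bar>g x\<bar>) \<le> (f x)\<^sup>2 + (g x)\<^sup>2" by simp
    moreover have "0 \<le> \<bar>f x\<bar> * \<bar>g x\<bar>" by simp
    ultimately have "\<bar>f x\<bar> * \<bar>g x\<bar> \<le> (f x)\<^sup>2 + (g x)\<^sup>2" by linarith
    then show "norm (f x * g x) \<le> norm ((f x)\<^sup>2 + (g x)\<^sup>2)" by (simp add: abs_mult)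
  qed
qed measurable

lemma integrable_square_diff:
  fixes f g :: "'a \<Rightarrow> real"
  assumes "f \<in> borel_measurable M" "g \<in> borel_measurable M"
    and "integrable M (\<lambda>x. (f x)\<^sup>2)" "integrable M (\<lambda>x. (g x)\<^sup>2)"
  shows "integrable M (\<lambda>x. (f x - g x)\<^sup>2)"
  unfolding power2_diff using assms integrable_mult_of_squares[OF assms] by (auto simp: mult.assoc)

text \<open>The integral of \<open>(G * f - C * g)\<^sup>2\<close> is nonnegative, where \<open>G\<close> is the integral of \<open>g\<^sup>2\<close> and \<open>C\<close>
  that of \<open>f * g\<close>.\<close>

lemma Cauchy_Schwarz_integral:
  fixes f g :: "'a \<Rightarrow> real"
  assumes m: "f \<in> borel_measurable M" "g \<in> borel_measurable M"
    and sq: "integrable M (\<lambda>x. (f x)\<^sup>2)" "integrable M (\<lambda>x. (g x)\<^sup>2)"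
  shows "(\<integral>x. f x * g x \<partial>M)\<^sup>2 \<le> (\<integral>x. (f x)\<^sup>2 \<partial>M) * (\<integral>x. (g x)\<^sup>2 \<partial>M)"
proof (cases "(\<integral>x. (g x)\<^sup>2 \<partial>M) = 0")
  case True
  then have "AE x in M. g x = 0"
    using sq by (subst (asm) integral_nonneg_eq_0_iff_AE) auto
  then have "AE x in M. f x * g x = 0" by eventually_elim simp
  then have "(\<integral>x. f x * g x \<partial>M) = 0"
    by (rule integral_eq_zero_AE)
  then show ?thesis using True by simp
next
  case False
  define G where "G = (\<integral>x. (g x)\<^sup>2 \<partial>M)"
  define C where "C = (\<integral>x. f x * g x \<partial>M)"
  have "G > 0" using False by (simp add: G_def order_less_le)
  have fg: "integrable M (\<lambda>x. f x * g x)" by (rule integrable_mult_of_squares) fact+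
  have eq: "(G * f x - C * g x)\<^sup>2 = G\<^sup>2 * (f x)\<^sup>2 - 2 * G * C * (f x * g x) + C\<^sup>2 * (g x)\<^sup>2" for x
    by (simp add: power2_eq_square algebra_simps)
  have "0 \<le> (\<integral>x. (G * f x - C * g x)\<^sup>2 \<partial>M)" by simp
  also have "\<dots> = G\<^sup>2 * (\<integral>x. (f x)\<^sup>2 \<partial>M) - 2 * G * C * C + C\<^sup>2 * G"
    unfolding eq using fg sq by (simp add: C_def G_def)
  also have "\<dots> = G * (G * (\<integral>x. (f x)\<^sup>2 \<partial>M) - C\<^sup>2)"
    by (simp add: power2_eq_square algebra_simps)
  finally have "0 \<le> G * (\<integral>x. (f x)\<^sup>2 \<partial>M) - C\<^sup>2"
    using \<open>G > 0\<close> by (simp add: zero_le_mult_iff)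
  then show ?thesis by (simp add: C_def G_def mult.commute)
qed

lemma (in prob_space) centered_gaussian_square_integrable:
  assumes "centered_gaussian M W"
  shows "integrable M (\<lambda>\<omega>. (W \<omega>)\<^sup>2)"
proof -
  have W [measurable]: "W \<in> borel_measurable M" using assms by (simp add: centered_gaussian_def)
  show ?thesis
  proof (cases "AE \<omega> in M. W \<omega> = 0")
    case True
    then have "AE \<omega> in M. (W \<omega>)\<^sup>2 = 0" by eventually_elim simp
    then show ?thesis by (subst integrable_cong_AE[where g = "\<lambda>_. 0"]) auto
  next
    case False
    with assms obtain \<sigma> where "\<sigma> > 0" and D: "distributed M lborel W (normal_density 0 \<sigma>)"
      by (auto simp: centered_gaussian_def)
    show ?thesis
      using integrable_normal_moment[OF \<open>\<sigma> > 0\<close>, of 0 2]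
      by (subst distributed_integrable[OF D, symmetric]) auto
  qed
qed

text \<open>The density is at most \<open>1 / (\<sigma> * sqrt (2 * pi))\<close>, and \<open>sqrt (2 * pi) \<ge> 2\<close>.  While
  Chebyshev's inequality derives concentration from a small deviation, this bounds the standard deviation from above by concentration near \<open>0\<close>.\<close>

lemma (in prob_space) centered_gaussian_small_ball:
  assumes "centered_gaussian M W" and "e \<ge> 0"
  shows "sqrt (expectation (\<lambda>\<omega>. (W \<omega>)\<^sup>2)) * prob {\<omega>\<in>space M. \<bar>W \<omega>\<bar> \<le> e} \<le> e"
proof (cases "AE \<omega> in M. W \<omega> = 0")
  case True
  then have "AE \<omega> in M. (W \<omega>)\<^sup>2 = 0" by eventually_elim simp
  then have "expectation (\<lambda>\<omega>. (W \<omega>)\<^sup>2) = 0" by (rule integral_eq_zero_AE)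
  then show ?thesis using \<open>e \<ge> 0\<close> by simp
next
  case False
  with assms obtain \<sigma> where "\<sigma> > 0" and D: "distributed M lborel W (normal_density 0 \<sigma>)"
    by (auto simp: centered_gaussian_def)
  have E: "expectation (\<lambda>\<omega>. (W \<omega>)\<^sup>2) = \<sigma>\<^sup>2"
    using normal_distributed_variance[OF \<open>\<sigma> > 0\<close> D] normal_distributed_expectation[OF \<open>\<sigma> > 0\<close> D]
    by simp
  define m where "m = 1 / sqrt (2 * pi * \<sigma>\<^sup>2)"
  have "m \<ge> 0" by (simp add: m_def)
  have "emeasure M (W -` {-e..e} \<inter> space M)
      = (\<integral>\<^sup>+x. ennreal (normal_density 0 \<sigma> x) * indicator {-e..e} x \<partial>lborel)"
    by (rule distributed_emeasure[OF D]) simp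
  also have "\<dots> \<le> (\<integral>\<^sup>+x. ennreal m * indicator {-e..e} x \<partial>lborel)"
  proof (intro nn_integral_mono mult_right_mono ennreal_leI)
    fix x :: real
    have "exp (- x\<^sup>2 / (2 * \<sigma>\<^sup>2)) \<le> 1" by simp
    then show "normal_density 0 \<sigma> x \<le> m"
      using \<open>m \<ge> 0\<close> mult_left_mono[of "exp (- x\<^sup>2 / (2 * \<sigma>\<^sup>2))" 1 m]
      by (simp add: normal_density_def m_def)
  qed simp
  also have "\<dots> = ennreal (m * (2 * e))"
    using \<open>e \<ge> 0\<close> \<open>m \<ge> 0\<close> by (simp add: nn_integral_cmult_indicator ennreal_mult)
  finally have "prob (W -` {-e..e} \<inter> space M) \<le> m * (2 * e)"
    using \<open>e \<ge> 0\<close> \<open>m \<ge> 0\<close> by (simp add: emeasure_eq_measure ennreal_le_iff)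
  moreover have "W -` {-e..e} \<inter> space M = {\<omega>\<in>space M. \<bar>W \<omega>\<bar> \<le> e}" by auto
  ultimately have "\<sigma> * prob {\<omega>\<in>space M. \<bar>W \<omega>\<bar> \<le> e} \<le> \<sigma> * (m * (2 * e))"
    using \<open>\<sigma> > 0\<close> by simp
  also have "\<dots> = 2 / sqrt (2 * pi) * e"
    using \<open>\<sigma> > 0\<close> by (simp add: m_def real_sqrt_mult)
  also have "\<dots> \<le> 1 * e"
  proof (rule mult_right_mono)
    have "2\<^sup>2 \<le> 2 * pi" using pi_gt3 by simp
    then have "2 \<le> sqrt (2 * pi)" by (rule real_le_rsqrt)
    then show "2 / sqrt (2 * pi) \<le> 1" by simp
  qed fact
  finally show ?thesis using E \<open>\<sigma> > 0\<close> by simp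
qed

locale gaussian_process = prob_space N for N :: "'b measure" +
  fixes T :: real and U :: "real \<Rightarrow> 'b \<Rightarrow> real"
  assumes T_pos: "0 < T" and process: "continuous_centered_gaussian_process N T U"
begin

lemma U_measurable [measurable]: "t \<in> {0..T} \<Longrightarrow> U t \<in> borel_measurable N"
  using process by (simp add: continuous_centered_gaussian_process_def)

lemma U_continuous: "\<omega> \<in> space N \<Longrightarrow> continuous_on {0..T} (\<lambda>t. U t \<omega>)"
  using process by (simp add: continuous_centered_gaussian_process_def)

lemma linear_combination_gaussian:
  "finite F \<Longrightarrow> F \<subseteq> {0..T} \<Longrightarrow> centered_gaussian N (\<lambda>\<omega>. \<Sum>t\<in>F. c t * U t \<omega>)"
  using process by (simp add: continuous_centered_gaussian_process_def)

lemma U_gaussian: "t \<in> {0..T} \<Longrightarrow> centered_gaussian N (U t)"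
  using linear_combination_gaussian[of "{t}" "\<lambda>_. 1"] by simp

lemma U_diff_gaussian:
  assumes "s \<in> {0..T}" "t \<in> {0..T}"
  shows "centered_gaussian N (\<lambda>\<omega>. U s \<omega> - U t \<omega>)"
proof (cases "s = t")
  case True
  then show ?thesis by (simp add: centered_gaussian_def)
next
  case False
  then show ?thesis
    using linear_combination_gaussian[of "{s, t}" "\<lambda>r. if r = s then 1 else -1"] assms by simp
qed

lemma U_square_integrable: "t \<in> {0..T} \<Longrightarrow> integrable N (\<lambda>\<omega>. (U t \<omega>)\<^sup>2)"
  by (intro centered_gaussian_square_integrable U_gaussian)

text \<open>Along \<open>s n \<longlonglongrightarrow> t\<close> the increments tend to \<open>0\<close> on every path, hence in probability; the small ball estimate
  turns this into convergence of their standard deviations.\<close>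

lemma U_L2_continuous:
  assumes s: "\<And>n. s n \<in> {0..T}" and t: "t \<in> {0..T}" and lim: "s \<longlonglongrightarrow> t"
  shows "(\<lambda>n. expectation (\<lambda>\<omega>. (U (s n) \<omega> - U t \<omega>)\<^sup>2)) \<longlonglongrightarrow> 0"
proof -
  define \<sigma> where "\<sigma> = (\<lambda>n. sqrt (expectation (\<lambda>\<omega>. (U (s n) \<omega> - U t \<omega>)\<^sup>2)))"
  have \<sigma>0: "\<sigma> n \<ge> 0" for n by (simp add: \<sigma>_def)
  have path: "(\<lambda>n. U (s n) \<omega> - U t \<omega>) \<longlonglongrightarrow> 0" if "\<omega> \<in> space N" for \<omega>
  proof -
    have "(\<lambda>n. U (s n) \<omega>) \<longlonglongrightarrow> U t \<omega>"
      using U_continuous[OF that] s t lim by (auto simp: continuous_on_sequentially o_def)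
    then show ?thesis by (simp add: LIM_zero_iff)
  qed
  note [measurable] = U_measurable[OF s] U_measurable[OF t]
  have "\<sigma> \<longlonglongrightarrow> 0"
  proof (rule LIMSEQ_I)
    fix e :: real assume "e > 0"
    \<comment> \<open>A centered Gaussian variable that lies in \<open>[- e / 4, e / 4]\<close> with probability more than \<open>1/2\<close> has
      standard deviation at most \<open>e / 2\<close>.\<close>
    define P where "P = (\<lambda>n. prob {\<omega>\<in>space N. \<bar>U (s n) \<omega> - U t \<omega>\<bar> \<le> e / 4})"
    have "(\<lambda>n. expectation (\<lambda>\<omega>. indicator {\<omega>\<in>space N. \<bar>U (s n) \<omega> - U t \<omega>\<bar> \<le> e / 4} \<omega> :: real))
        \<longlonglongrightarrow> expectation (\<lambda>\<omega>. 1)"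
    proof (rule integral_dominated_convergence[where w = "\<lambda>_. 1"])
      show "AE \<omega> in N. (\<lambda>n. indicator {\<omega>\<in>space N. \<bar>U (s n) \<omega> - U t \<omega>\<bar> \<le> e / 4} \<omega> :: real) \<longlonglongrightarrow> 1"
      proof (rule AE_I2)
        fix \<omega> assume \<omega>: "\<omega> \<in> space N"
        have "eventually (\<lambda>n. \<bar>U (s n) \<omega> - U t \<omega>\<bar> < e / 4) sequentially"
          using tendstoD[OF path[OF \<omega>], of "e / 4"] \<open>e > 0\<close> by (simp add: dist_real_def)
        then have "eventually (\<lambda>n. (indicator {\<omega>\<in>space N. \<bar>U (s n) \<omega> - U t \<omega>\<bar> \<le> e / 4} \<omega> :: real) = 1) sequentially"
          by eventually_elim (use \<omega> in \<open>auto simp: indicator_def\<close>)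
        then show "(\<lambda>n. indicator {\<omega>\<in>space N. \<bar>U (s n) \<omega> - U t \<omega>\<bar> \<le> e / 4} \<omega> :: real) \<longlonglongrightarrow> 1"
          by (rule tendsto_eventually)
      qed
    qed (auto simp: indicator_def)
    then have "P \<longlonglongrightarrow> 1" by (simp add: P_def prob_space)
    then have "eventually (\<lambda>n. P n > 1/2) sequentially" by (rule order_tendstoD) simp
    then have "eventually (\<lambda>n. norm (\<sigma> n - 0) < e) sequentially"
    proof eventually_elim
      case (elim n)
      have "\<sigma> n * (1/2) \<le> \<sigma> n * P n" using elim \<sigma>0[of n] by (intro mult_left_mono) auto
      also have "\<dots> \<le> e / 4"
        unfolding \<sigma>_def P_def using \<open>e > 0\<close> s t
        by (intro centered_gaussian_small_ball U_diff_gaussian) auto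
      finally show ?case using \<open>e > 0\<close> \<sigma>0[of n] by simp
    qed
    then show "\<exists>no. \<forall>n\<ge>no. norm (\<sigma> n - 0) < e" by (simp add: eventually_sequentially)
  qed
  then have "(\<lambda>n. (\<sigma> n)\<^sup>2) \<longlonglongrightarrow> 0\<^sup>2" by (rule tendsto_power)
  then show ?thesis by (simp add: \<sigma>_def)
qed

text \<open>Otherwise the variances would be unbounded along a sequence of times; a convergent subsequence
  contradicts \<open>L\<^sup>2\<close>-continuity at its limit.\<close>

lemma variance_bounded: "\<exists>K\<ge>0. \<forall>t\<in>{0..T}. expectation (\<lambda>\<omega>. (U t \<omega>)\<^sup>2) \<le> K"
proof -
  have "\<exists>K. \<forall>t\<in>{0..T}. expectation (\<lambda>\<omega>. (U t \<omega>)\<^sup>2) \<le> K"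
  proof (rule ccontr)
    assume "\<not> ?thesis"
    then have "\<forall>n::nat. \<exists>t\<in>{0..T}. expectation (\<lambda>\<omega>. (U t \<omega>)\<^sup>2) > real n"
      by (metis not_le)
    then obtain s where s: "\<And>n. s n \<in> {0..T}"
      and big: "\<And>n. expectation (\<lambda>\<omega>. (U (s n) \<omega>)\<^sup>2) > real n" by metis
    have "seq_compact {0..T}" by (simp add: compact_eq_seq_compact_metric[symmetric])
    then obtain l r where l: "l \<in> {0..T}" "strict_mono r" "(s \<circ> r) \<longlonglongrightarrow> l"
      using s unfolding seq_compact_def by blast
    define D where "D = (\<lambda>n. expectation (\<lambda>\<omega>. (U (s (r n)) \<omega> - U l \<omega>)\<^sup>2))"
    have "D \<longlonglongrightarrow> 0" unfolding D_def using U_L2_continuous[of "s \<circ> r" l] s l by simp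
    then have "eventually (\<lambda>n. D n < 1) sequentially" by (rule order_tendstoD) simp
    moreover have "eventually (\<lambda>n. real n > 2 * expectation (\<lambda>\<omega>. (U l \<omega>)\<^sup>2) + 2) sequentially"
      using eventually_gt_at_top[of "nat \<lceil>2 * expectation (\<lambda>\<omega>. (U l \<omega>)\<^sup>2) + 2\<rceil>"]
      by eventually_elim linarith
    ultimately have "eventually (\<lambda>n. False) sequentially"
    proof eventually_elim
      case (elim n)
      note m = U_measurable[OF s, of "r n"] U_measurable[OF l(1)]
      note sq = U_square_integrable[OF s, of "r n"] U_square_integrable[OF l(1)]
      note sqd = integrable_square_diff[OF m sq]
      have "expectation (\<lambda>\<omega>. (U (s (r n)) \<omega>)\<^sup>2)
          \<le> expectation (\<lambda>\<omega>. 2 * (U (s (r n)) \<omega> - U l \<omega>)\<^sup>2 + 2 * (U l \<omega>)\<^sup>2)"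
      proof (rule integral_mono)
        fix \<omega>
        have "0 \<le> (U (s (r n)) \<omega> - 2 * U l \<omega>)\<^sup>2" by simp
        then show "(U (s (r n)) \<omega>)\<^sup>2 \<le> 2 * (U (s (r n)) \<omega> - U l \<omega>)\<^sup>2 + 2 * (U l \<omega>)\<^sup>2"
          by (simp add: power2_eq_square algebra_simps)
      qed (use sq sqd in auto)
      also have "\<dots> = 2 * D n + 2 * expectation (\<lambda>\<omega>. (U l \<omega>)\<^sup>2)"
        unfolding D_def using sq sqd by simp
      also have "\<dots> < real n" using elim by simp
      also have "real n \<le> real (r n)" using seq_suble[OF l(2)] by simp
      finally show False using big[of "r n"] by simp
    qed
    then show False by simp
  qed
  then obtain K where K: "\<And>t. t \<in> {0..T} \<Longrightarrow> expectation (\<lambda>\<omega>. (U t \<omega>)\<^sup>2) \<le> K" by blast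
  have "0 \<le> expectation (\<lambda>\<omega>. (U 0 \<omega>)\<^sup>2)" by simp
  also have "\<dots> \<le> K" using K[of 0] T_pos by simp
  finally have "K \<ge> 0" .
  with K show ?thesis by blast
qed

text \<open>The elements of the RKHS are continuous, by the Cauchy-Schwarz inequality and \<open>L\<^sup>2\<close>-continuity.\<close>

lemma covariance_with_continuous:
  assumes Y: "Y \<in> borel_measurable N" "integrable N (\<lambda>\<omega>. (Y \<omega>)\<^sup>2)"
  shows "continuous_on {0..T} (\<lambda>t. expectation (\<lambda>\<omega>. U t \<omega> * Y \<omega>))"
proof (rule continuous_on_sequentiallyI)
  fix s t assume s: "\<forall>n. s n \<in> {0..T}" and t: "t \<in> {0..T}" and lim: "s \<longlonglongrightarrow> t"
  define f where "f = (\<lambda>t. expectation (\<lambda>\<omega>. U t \<omega> * Y \<omega>))"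
  have sq: "(f (s n) - f t)\<^sup>2 \<le> expectation (\<lambda>\<omega>. (U (s n) \<omega> - U t \<omega>)\<^sup>2) * expectation (\<lambda>\<omega>. (Y \<omega>)\<^sup>2)" for n
  proof -
    have sn: "s n \<in> {0..T}" using s by simp
    have "f (s n) - f t = expectation (\<lambda>\<omega>. (U (s n) \<omega> - U t \<omega>) * Y \<omega>)"
      using sn t Y unfolding f_def
      by (subst Bochner_Integration.integral_diff[symmetric])
         (auto intro!: integrable_mult_of_squares U_square_integrable simp: algebra_simps)
    also have "\<dots>\<^sup>2 \<le> expectation (\<lambda>\<omega>. (U (s n) \<omega> - U t \<omega>)\<^sup>2) * expectation (\<lambda>\<omega>. (Y \<omega>)\<^sup>2)"
      using sn t Y
      by (intro Cauchy_Schwarz_integral integrable_square_diff U_square_integrable borel_measurable_diff) auto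
    finally show ?thesis .
  qed
  have "(\<lambda>n. (f (s n) - f t)\<^sup>2) \<longlonglongrightarrow> 0"
  proof (rule tendsto_sandwich[OF _ _ tendsto_const])
    show "(\<lambda>n. expectation (\<lambda>\<omega>. (U (s n) \<omega> - U t \<omega>)\<^sup>2) * expectation (\<lambda>\<omega>. (Y \<omega>)\<^sup>2)) \<longlonglongrightarrow> 0"
      using U_L2_continuous[of s t] s t lim by (auto intro!: tendsto_mult_left_zero)
  qed (use sq in auto)
  then have "(\<lambda>n. f (s n) - f t) \<longlonglongrightarrow> 0" by (simp add: power_tendsto_0_iff)
  then show "(\<lambda>n. f (s n)) \<longlonglongrightarrow> f t" by (simp add: LIM_zero_iff)
qed

text \<open>On each path, \<open>U t\<close> is the limit of its values at the grid points \<open>\<lfloor>(n + 1) * t\<rfloor> / (n + 1)\<close>, and a process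
  that is constant between countably many fixed times is jointly measurable.\<close>

lemma jointly_measurable:
  assumes R: "sets \<mu> = sets (restrict_space borel {0..T})"
  shows "(\<lambda>(t, \<omega>). U t \<omega>) \<in> borel_measurable (\<mu> \<Otimes>\<^sub>M N)"
proof (rule borel_measurable_LIMSEQ_metric)
  have sp: "space \<mu> = {0..T}" using sets_eq_imp_space_eq[OF R] by (simp add: space_restrict_space)
  have id: "(\<lambda>t. t) \<in> borel_measurable \<mu>"
    using measurable_restrict_space1[OF measurable_ident, of borel "{0..T}"]
    by (simp add: measurable_cong_sets[OF R refl] id_def)
  \<comment> \<open>Countably many integers index the grid, most of them outside \<open>[0, T]\<close>, where nothing is known about
    \<open>U\<close>; the clamp keeps every index meaningful and does not move the grid points that occur.\<close>
  define proj :: "real \<Rightarrow> real" where "proj = (\<lambda>t. max 0 (min T t))"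
  define g where "g = (\<lambda>n t. \<lfloor>real (Suc n) * t\<rfloor>)"
  define V where "V = (\<lambda>n (t, \<omega>). U (proj (of_int (g n t) / real (Suc n))) \<omega>)"
  have proj: "proj t \<in> {0..T}" for t using T_pos by (auto simp: proj_def)
  show "V n \<in> borel_measurable (\<mu> \<Otimes>\<^sub>M N)" for n
  proof -
    have "(\<lambda>p. U (proj (of_int (g n (fst p)) / real (Suc n))) (snd p)) \<in> borel_measurable (\<mu> \<Otimes>\<^sub>M N)"
    proof (rule measurable_compose_countable[where
        f = "\<lambda>i p. U (proj (of_int i / real (Suc n))) (snd p)" and g = "\<lambda>p. g n (fst p)"])
      show "(\<lambda>p. U (proj (of_int i / real (Suc n))) (snd p)) \<in> borel_measurable (\<mu> \<Otimes>\<^sub>M N)" for i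
        by (rule measurable_compose[OF measurable_snd U_measurable[OF proj]])
      have "(\<lambda>t. g n t) \<in> measurable \<mu> (count_space UNIV)"
        unfolding g_def using id by measurable
      then show "(\<lambda>p. g n (fst p)) \<in> measurable (\<mu> \<Otimes>\<^sub>M N) (count_space UNIV)"
        by (rule measurable_compose[OF measurable_fst])
    qed
    then show ?thesis by (simp add: V_def case_prod_beta')
  qed
  fix p assume p: "p \<in> space (\<mu> \<Otimes>\<^sub>M N)"
  obtain t \<omega> where p_eq: "p = (t, \<omega>)" and t: "t \<in> {0..T}" and \<omega>: "\<omega> \<in> space N"
    using p sp by (auto simp: space_pair_measure)
  define s where "s = (\<lambda>n. proj (of_int (g n t) / real (Suc n)))"
  have s_le: "of_int (g n t) / real (Suc n) \<le> t" and s_ge: "t - 1 / real (Suc n) \<le> of_int (g n t) / real (Suc n)"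
    and s_0: "0 \<le> of_int (g n t) / real (Suc n)" for n
  proof -
    have "of_int (g n t) \<le> real (Suc n) * t" unfolding g_def by linarith
    then show "of_int (g n t) / real (Suc n) \<le> t" by (simp add: field_simps)
    have "real (Suc n) * t - 1 \<le> of_int (g n t)" unfolding g_def by linarith
    then have "(real (Suc n) * t - 1) / real (Suc n) \<le> of_int (g n t) / real (Suc n)"
      by (intro divide_right_mono) auto
    then show "t - 1 / real (Suc n) \<le> of_int (g n t) / real (Suc n)"
      by (simp only: diff_divide_distrib) simp
    have "0 \<le> real (Suc n) * t" using t by simp
    then have "0 \<le> g n t" by (simp add: g_def)
    then show "0 \<le> of_int (g n t) / real (Suc n)" by simp
  qed
  have s_eq: "s n = of_int (g n t) / real (Suc n)" for n
    using s_le[of n] s_0[of n] t by (simp add: s_def proj_def)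
  have "s \<longlonglongrightarrow> t"
  proof (rule tendsto_sandwich[OF _ _ _ tendsto_const])
    have "(\<lambda>n. t - inverse (real (Suc n))) \<longlonglongrightarrow> t - 0"
      by (intro tendsto_diff tendsto_const LIMSEQ_inverse_real_of_nat)
    then show "(\<lambda>n. t - 1 / real (Suc n)) \<longlonglongrightarrow> t" by (simp add: inverse_eq_divide)
  qed (use s_le s_ge in \<open>auto simp: s_eq\<close>)
  moreover have "s n \<in> {0..T}" for n by (simp add: s_def proj[unfolded atLeastAtMost_iff])
  ultimately have "(\<lambda>n. U (s n) \<omega>) \<longlonglongrightarrow> U t \<omega>"
    using U_continuous[OF \<omega>] t by (auto simp: continuous_on_sequentially o_def)
  then show "(\<lambda>n. V n p) \<longlonglongrightarrow> (case p of (t, \<omega>) \<Rightarrow> U t \<omega>)"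
    by (simp add: V_def p_eq s_def)
qed

text \<open>Fubini's theorem exchanges the integral along the path with the expectation; it applies because the
  variances are bounded.\<close>

lemma path_integral_L2:
  assumes "finite_measure_on T \<mu>"
  shows "(\<lambda>\<omega>. \<integral>t. U t \<omega> \<partial>\<mu>) \<in> borel_measurable N" (is ?meas)
    and "integrable N (\<lambda>\<omega>. (\<integral>t. U t \<omega> \<partial>\<mu>)\<^sup>2)" (is ?int)
    and "\<And>D. D \<in> borel_measurable N \<Longrightarrow> integrable N (\<lambda>\<omega>. (D \<omega>)\<^sup>2) \<Longrightarrow>
      (\<And>t. t \<in> {0..T} \<Longrightarrow> expectation (\<lambda>\<omega>. U t \<omega> * D \<omega>) = 0) \<Longrightarrow>
      expectation (\<lambda>\<omega>. D \<omega> * (\<integral>t. U t \<omega> \<partial>\<mu>)) = 0"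
proof -
  interpret \<mu>: finite_measure \<mu> using assms by (simp add: finite_measure_on_def)
  have R: "sets \<mu> = sets (restrict_space borel {0..T})" using assms by (simp add: finite_measure_on_def)
  have sp: "space \<mu> = {0..T}" using sets_eq_imp_space_eq[OF R] by (simp add: space_restrict_space)
  interpret P: pair_sigma_finite \<mu> N ..
  have J [measurable]: "(\<lambda>(t, \<omega>). U t \<omega>) \<in> borel_measurable (\<mu> \<Otimes>\<^sub>M N)"
    by (rule jointly_measurable[OF R])
  have J' [measurable]: "(\<lambda>(\<omega>, t). U t \<omega>) \<in> borel_measurable (N \<Otimes>\<^sub>M \<mu>)"
    using measurable_pair_swap[OF J] by (simp add: case_prod_beta')
  show meas: ?meas by (rule \<mu>.borel_measurable_lebesgue_integral) (use J' in simp)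
  obtain K where K: "K \<ge> 0" "\<And>t. t \<in> {0..T} \<Longrightarrow> expectation (\<lambda>\<omega>. (U t \<omega>)\<^sup>2) \<le> K"
    using variance_bounded by blast
  have U2: "integrable (\<mu> \<Otimes>\<^sub>M N) (\<lambda>(t, \<omega>). (U t \<omega>)\<^sup>2)"
  proof (rule P.Fubini_integrable)
    show "integrable \<mu> (\<lambda>t. \<integral>\<omega>. norm (case (t, \<omega>) of (t, \<omega>) \<Rightarrow> (U t \<omega>)\<^sup>2) \<partial>N)"
    proof (rule \<mu>.integrable_const_bound[where B = K])
      show "AE t in \<mu>. norm (\<integral>\<omega>. norm (case (t, \<omega>) of (t, \<omega>) \<Rightarrow> (U t \<omega>)\<^sup>2) \<partial>N) \<le> K"
        using K(2) by (intro AE_I2) (simp add: sp)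
    qed measurable
    show "AE t in \<mu>. integrable N (\<lambda>\<omega>. case (t, \<omega>) of (t, \<omega>) \<Rightarrow> (U t \<omega>)\<^sup>2)"
      using U_square_integrable by (intro AE_I2) (simp add: sp)
  qed measurable
  have path: "(\<lambda>t. U t \<omega>) \<in> borel_measurable \<mu>" "integrable \<mu> (\<lambda>t. (U t \<omega>)\<^sup>2)" if "\<omega> \<in> space N" for \<omega>
  proof -
    show m: "(\<lambda>t. U t \<omega>) \<in> borel_measurable \<mu>"
      using borel_measurable_continuous_on_restrict[OF U_continuous[OF that]]
      by (simp add: measurable_cong_sets[OF R refl])
    have "compact ((\<lambda>t. U t \<omega>) ` {0..T})"
      by (intro compact_continuous_image U_continuous that) simp
    then obtain B where B: "\<And>t. t \<in> {0..T} \<Longrightarrow> \<bar>U t \<omega>\<bar> \<le> B"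
      by (metis compact_imp_bounded bounded_real imageI)
    have "(U t \<omega>)\<^sup>2 \<le> B\<^sup>2" if "t \<in> {0..T}" for t
      using B[OF that] by (metis abs_ge_zero order_trans power2_abs power_mono)
    then show "integrable \<mu> (\<lambda>t. (U t \<omega>)\<^sup>2)"
      using m by (intro \<mu>.integrable_const_bound[where B = "B\<^sup>2"] AE_I2) (auto simp: sp)
  qed
  show ?int
  proof (rule Bochner_Integration.integrable_bound)
    show "integrable N (\<lambda>\<omega>. (\<integral>t. (U t \<omega>)\<^sup>2 \<partial>\<mu>) * measure \<mu> (space \<mu>))"
      using P.integrable_snd[OF U2] by simp
    show "AE \<omega> in N. norm ((\<integral>t. U t \<omega> \<partial>\<mu>)\<^sup>2) \<le> norm ((\<integral>t. (U t \<omega>)\<^sup>2 \<partial>\<mu>) * measure \<mu> (space \<mu>))"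
    proof (rule AE_I2)
      fix \<omega> assume \<omega>: "\<omega> \<in> space N"
      have "(\<integral>t. U t \<omega> * 1 \<partial>\<mu>)\<^sup>2 \<le> (\<integral>t. (U t \<omega>)\<^sup>2 \<partial>\<mu>) * (\<integral>t. 1\<^sup>2 \<partial>\<mu>)"
        using path[OF \<omega>] by (intro Cauchy_Schwarz_integral) auto
      then show "norm ((\<integral>t. U t \<omega> \<partial>\<mu>)\<^sup>2) \<le> norm ((\<integral>t. (U t \<omega>)\<^sup>2 \<partial>\<mu>) * measure \<mu> (space \<mu>))"
        by (auto intro: order_trans)
    qed
  qed (use meas in measurable)
  fix D assume D [measurable]: "D \<in> borel_measurable N" and D2: "integrable N (\<lambda>\<omega>. (D \<omega>)\<^sup>2)"
    and orth: "\<And>t. t \<in> {0..T} \<Longrightarrow> expectation (\<lambda>\<omega>. U t \<omega> * D \<omega>) = 0"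
  have UD: "integrable (\<mu> \<Otimes>\<^sub>M N) (\<lambda>(t, \<omega>). U t \<omega> * D \<omega>)"
  proof (rule P.Fubini_integrable)
    show "integrable \<mu> (\<lambda>t. \<integral>\<omega>. norm (case (t, \<omega>) of (t, \<omega>) \<Rightarrow> U t \<omega> * D \<omega>) \<partial>N)"
    proof (rule \<mu>.integrable_const_bound[where B = "K + expectation (\<lambda>\<omega>. (D \<omega>)\<^sup>2)"])
      show "AE t in \<mu>. norm (\<integral>\<omega>. norm (case (t, \<omega>) of (t, \<omega>) \<Rightarrow> U t \<omega> * D \<omega>) \<partial>N)
          \<le> K + expectation (\<lambda>\<omega>. (D \<omega>)\<^sup>2)"
      proof (rule AE_I2)
        fix t assume "t \<in> space \<mu>"
        then have t: "t \<in> {0..T}" by (simp add: sp)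
        have "(\<integral>\<omega>. \<bar>U t \<omega> * D \<omega>\<bar> \<partial>N) \<le> (\<integral>\<omega>. (U t \<omega>)\<^sup>2 + (D \<omega>)\<^sup>2 \<partial>N)"
        proof (rule integral_mono)
          show "integrable N (\<lambda>\<omega>. \<bar>U t \<omega> * D \<omega>\<bar>)"
            using t D2 by (intro integrable_abs integrable_mult_of_squares U_square_integrable) auto
          show "integrable N (\<lambda>\<omega>. (U t \<omega>)\<^sup>2 + (D \<omega>)\<^sup>2)" using t D2 U_square_integrable by simp
          fix \<omega>
          have "0 \<le> (\<bar>U t \<omega>\<bar> - \<bar>D \<omega>\<bar>)\<^sup>2" "0 \<le> \<bar>U t \<omega>\<bar> * \<bar>D \<omega>\<bar>" by auto
          then show "\<bar>U t \<omega> * D \<omega>\<bar> \<le> (U t \<omega>)\<^sup>2 + (D \<omega>)\<^sup>2"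
            unfolding abs_mult power2_diff power2_abs by linarith
        qed
        also have "\<dots> \<le> K + expectation (\<lambda>\<omega>. (D \<omega>)\<^sup>2)"
          using t D2 U_square_integrable K by simp
        finally show "norm (\<integral>\<omega>. norm (case (t, \<omega>) of (t, \<omega>) \<Rightarrow> U t \<omega> * D \<omega>) \<partial>N)
          \<le> K + expectation (\<lambda>\<omega>. (D \<omega>)\<^sup>2)" by simp
      qed
    qed measurable
    show "AE t in \<mu>. integrable N (\<lambda>\<omega>. case (t, \<omega>) of (t, \<omega>) \<Rightarrow> U t \<omega> * D \<omega>)"
      using D2 by (intro AE_I2) (auto simp: sp intro!: integrable_mult_of_squares U_square_integrable)
  qed measurable
  have "expectation (\<lambda>\<omega>. D \<omega> * (\<integral>t. U t \<omega> \<partial>\<mu>)) = (\<integral>\<omega>. (\<integral>t. U t \<omega> * D \<omega> \<partial>\<mu>) \<partial>N)"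
    by (intro Bochner_Integration.integral_cong refl) (simp add: mult.commute)
  also have "\<dots> = (\<integral>t. (\<integral>\<omega>. U t \<omega> * D \<omega> \<partial>N) \<partial>\<mu>)"
    by (rule P.Fubini_integral[OF UD])
  also have "\<dots> = (\<integral>t. 0 \<partial>\<mu>)"
    using orth by (intro Bochner_Integration.integral_cong) (auto simp: sp)
  finally show "expectation (\<lambda>\<omega>. D \<omega> * (\<integral>t. U t \<omega> \<partial>\<mu>)) = 0" by simp
qed

lemma signed_integral_L2:
  assumes \<mu>: "finite_measure_on T \<mu>" and \<nu>: "finite_measure_on T \<nu>"
  shows "signed_integral \<mu> \<nu> U \<in> borel_measurable N"
    and "integrable N (\<lambda>\<omega>. (signed_integral \<mu> \<nu> U \<omega>)\<^sup>2)"
  unfolding signed_integral_def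
  using path_integral_L2(1,2)[OF \<mu>] path_integral_L2(1,2)[OF \<nu>]
  by (auto intro!: integrable_square_diff)

text \<open>Orthogonality to all \<open>U t\<close> passes to all \<open>\<integral>U d\<lambda>\<close> by \<open>path_integral_L2\<close>, and from there to the
  closure by the Cauchy-Schwarz inequality.\<close>

lemma orthogonal_to_H:
  assumes D: "D \<in> borel_measurable N" "integrable N (\<lambda>\<omega>. (D \<omega>)\<^sup>2)"
    and orth: "\<And>t. t \<in> {0..T} \<Longrightarrow> expectation (\<lambda>\<omega>. U t \<omega> * D \<omega>) = 0"
    and Y: "Y \<in> gaussian_H N T U"
  shows "expectation (\<lambda>\<omega>. D \<omega> * Y \<omega>) = 0"
proof -
  have Y': "Y \<in> borel_measurable N" "integrable N (\<lambda>\<omega>. (Y \<omega>)\<^sup>2)"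
    using Y by (auto simp: gaussian_H_def)
  define a where "a = expectation (\<lambda>\<omega>. (D \<omega>)\<^sup>2)"
  have "a \<ge> 0" by (simp add: a_def)
  have *: "(expectation (\<lambda>\<omega>. D \<omega> * Y \<omega>))\<^sup>2 \<le> a * \<epsilon>" if "\<epsilon> > 0" for \<epsilon>
  proof -
    from Y that obtain \<mu> \<nu> where \<mu>: "finite_measure_on T \<mu>" and \<nu>: "finite_measure_on T \<nu>"
      and close: "expectation (\<lambda>\<omega>. (Y \<omega> - signed_integral \<mu> \<nu> U \<omega>)\<^sup>2) < \<epsilon>"
      by (auto simp: gaussian_H_def)
    define S where "S = signed_integral \<mu> \<nu> U"
    note S = signed_integral_L2[OF \<mu> \<nu>, folded S_def]
    note I\<mu> = path_integral_L2[OF \<mu>] and I\<nu> = path_integral_L2[OF \<nu>]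
    have "expectation (\<lambda>\<omega>. D \<omega> * S \<omega>)
        = expectation (\<lambda>\<omega>. D \<omega> * (\<integral>t. U t \<omega> \<partial>\<mu>)) - expectation (\<lambda>\<omega>. D \<omega> * (\<integral>t. U t \<omega> \<partial>\<nu>))"
      unfolding S_def signed_integral_def right_diff_distrib
      by (intro Bochner_Integration.integral_diff integrable_mult_of_squares D I\<mu>(1,2) I\<nu>(1,2))
    also have "\<dots> = 0" using I\<mu>(3)[OF D orth] I\<nu>(3)[OF D orth] by simp
    finally have "expectation (\<lambda>\<omega>. D \<omega> * Y \<omega>) = expectation (\<lambda>\<omega>. D \<omega> * Y \<omega>) - expectation (\<lambda>\<omega>. D \<omega> * S \<omega>)"
      by simp
    also have "\<dots> = expectation (\<lambda>\<omega>. D \<omega> * (Y \<omega> - S \<omega>))"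
      unfolding right_diff_distrib
      by (intro Bochner_Integration.integral_diff[symmetric] integrable_mult_of_squares D S Y')
    also have "\<dots>\<^sup>2 \<le> a * expectation (\<lambda>\<omega>. (Y \<omega> - S \<omega>)\<^sup>2)"
      unfolding a_def
      by (intro Cauchy_Schwarz_integral D integrable_square_diff S Y' borel_measurable_diff)
    also have "\<dots> \<le> a * \<epsilon>" using close \<open>a \<ge> 0\<close> by (intro mult_left_mono) (auto simp: S_def)
    finally show ?thesis .
  qed
  have "(expectation (\<lambda>\<omega>. D \<omega> * Y \<omega>))\<^sup>2 \<le> 0 + e" if "e > 0" for e
  proof -
    have "(expectation (\<lambda>\<omega>. D \<omega> * Y \<omega>))\<^sup>2 \<le> a * (e / (a + 1))"
      using that \<open>a \<ge> 0\<close> by (intro *) simp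
    also have "\<dots> \<le> e" using that \<open>a \<ge> 0\<close> by (simp add: field_simps)
    finally show ?thesis by simp
  qed
  then have "(expectation (\<lambda>\<omega>. D \<omega> * Y \<omega>))\<^sup>2 \<le> 0" by (rule field_le_epsilon)
  then show ?thesis by simp
qed

text \<open>If \<open>Y\<close> and \<open>Y'\<close> represent the same function, then \<open>Y - Y'\<close> is orthogonal to every \<open>U t\<close>, hence to \<open>Y\<close> and
  to \<open>Y'\<close>, so that \<open>E[Y\<^sup>2] - E[Y'\<^sup>2] = E[(Y - Y') * (Y + Y')] = 0\<close>.\<close>

lemma rkhs_norm_eq:
  assumes Y: "Y \<in> gaussian_H N T U"
  shows "rkhs_norm N T U (rkhs_map N T U Y) = sqrt (expectation (\<lambda>\<omega>. (Y \<omega>)\<^sup>2))"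
  unfolding rkhs_norm_def
proof (rule the_equality)
  fix r assume "\<exists>Y'\<in>gaussian_H N T U. rkhs_map N T U Y' = rkhs_map N T U Y
    \<and> r = sqrt (expectation (\<lambda>\<omega>. (Y' \<omega>)\<^sup>2))"
  then obtain Y' where Y': "Y' \<in> gaussian_H N T U" and eq: "rkhs_map N T U Y' = rkhs_map N T U Y"
    and r: "r = sqrt (expectation (\<lambda>\<omega>. (Y' \<omega>)\<^sup>2))" by blast
  have L2: "Y \<in> borel_measurable N" "integrable N (\<lambda>\<omega>. (Y \<omega>)\<^sup>2)"
    "Y' \<in> borel_measurable N" "integrable N (\<lambda>\<omega>. (Y' \<omega>)\<^sup>2)"
    using Y Y' by (auto simp: gaussian_H_def)
  define D where "D = (\<lambda>\<omega>. Y \<omega> - Y' \<omega>)"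
  have D: "D \<in> borel_measurable N" "integrable N (\<lambda>\<omega>. (D \<omega>)\<^sup>2)"
    unfolding D_def using L2 by (auto intro: integrable_square_diff)
  have "expectation (\<lambda>\<omega>. U t \<omega> * D \<omega>) = 0" if t: "t \<in> {0..T}" for t
  proof -
    have "expectation (\<lambda>\<omega>. U t \<omega> * D \<omega>) = expectation (\<lambda>\<omega>. U t \<omega> * Y \<omega>) - expectation (\<lambda>\<omega>. U t \<omega> * Y' \<omega>)"
      unfolding D_def right_diff_distrib
      by (intro Bochner_Integration.integral_diff integrable_mult_of_squares U_measurable U_square_integrable L2 t)
    also have "\<dots> = rkhs_map N T U Y t - rkhs_map N T U Y' t" using t by (simp add: rkhs_map_def)
    finally show ?thesis using eq by simp
  qed
  then have "expectation (\<lambda>\<omega>. D \<omega> * Y \<omega>) = 0" "expectation (\<lambda>\<omega>. D \<omega> * Y' \<omega>) = 0"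
    using orthogonal_to_H[OF D] Y Y' by auto
  then have "0 = expectation (\<lambda>\<omega>. D \<omega> * Y \<omega>) + expectation (\<lambda>\<omega>. D \<omega> * Y' \<omega>)" by simp
  also have "\<dots> = expectation (\<lambda>\<omega>. D \<omega> * Y \<omega> + D \<omega> * Y' \<omega>)"
    by (intro Bochner_Integration.integral_add[symmetric] integrable_mult_of_squares D L2)
  also have "\<dots> = expectation (\<lambda>\<omega>. (Y \<omega>)\<^sup>2 - (Y' \<omega>)\<^sup>2)"
    by (simp add: D_def power2_eq_square algebra_simps)
  also have "\<dots> = expectation (\<lambda>\<omega>. (Y \<omega>)\<^sup>2) - expectation (\<lambda>\<omega>. (Y' \<omega>)\<^sup>2)"
    using L2 by simp
  finally show "r = sqrt (expectation (\<lambda>\<omega>. (Y \<omega>)\<^sup>2))" by (simp add: r)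
qed (use Y in auto)

lemma gaussian_rate_rkhs_map:
  assumes "Y \<in> gaussian_H N T U"
  shows "gaussian_rate N T U (rkhs_map N T U Y) = ereal (1/2 * expectation (\<lambda>\<omega>. (Y \<omega>)\<^sup>2))"
  using assms by (simp add: gaussian_rate_def rkhs_def rkhs_norm_eq)

lemma gaussian_rate_nonneg: "0 \<le> gaussian_rate N T U h"
  by (simp add: gaussian_rate_def)

text \<open>The Cauchy-Schwarz inequality for \<open>h t = E[U t * Y]\<close>.\<close>

lemma gaussian_rate_evaluation_bound:
  assumes "gaussian_rate N T U h = ereal J" and t: "t \<in> {0..T}"
  shows "(h t)\<^sup>2 \<le> 2 * J * expectation (\<lambda>\<omega>. (U t \<omega>)\<^sup>2)"
proof -
  from assms(1) have "h \<in> rkhs N T U" by (auto simp: gaussian_rate_def split: if_splits)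
  then obtain Y where Y: "Y \<in> gaussian_H N T U" and h: "h = rkhs_map N T U Y" by (auto simp: rkhs_def)
  have L2: "Y \<in> borel_measurable N" "integrable N (\<lambda>\<omega>. (Y \<omega>)\<^sup>2)"
    using Y by (auto simp: gaussian_H_def)
  have J: "2 * J = expectation (\<lambda>\<omega>. (Y \<omega>)\<^sup>2)"
    using assms(1) gaussian_rate_rkhs_map[OF Y] h by simp
  have "(h t)\<^sup>2 = (expectation (\<lambda>\<omega>. U t \<omega> * Y \<omega>))\<^sup>2" using t by (simp add: h rkhs_map_def)
  also have "\<dots> \<le> expectation (\<lambda>\<omega>. (U t \<omega>)\<^sup>2) * expectation (\<lambda>\<omega>. (Y \<omega>)\<^sup>2)"
    by (intro Cauchy_Schwarz_integral U_measurable U_square_integrable L2 t)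
  finally show ?thesis unfolding J by (simp add: mult.commute)
qed

text \<open>The variable \<open>l * U t\<close> is the integral of \<open>U\<close> against a point mass of weight \<open>l\<close> at \<open>t\<close>, whose Jordan
  decomposition has the weights \<open>max l 0\<close> and \<open>max (- l) 0\<close>.\<close>

lemma scaled_evaluation_in_H:
  assumes t: "t \<in> {0..T}"
  shows "(\<lambda>\<omega>. l * U t \<omega>) \<in> gaussian_H N T U"
proof -
  let ?R = "restrict_space borel {0..T}"
  define \<delta> where "\<delta> = (\<lambda>c::real. density (return ?R t) (\<lambda>_. ennreal c))"
  have tR: "t \<in> space ?R" using t by (simp add: space_restrict_space)
  have fin: "finite_measure_on T (\<delta> c)" for c
    unfolding finite_measure_on_def
  proof
    show "finite_measure (\<delta> c)"
    proof
      have "emeasure (\<delta> c) (space (\<delta> c)) = ennreal c * emeasure (return ?R t) (space (return ?R t))"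
        unfolding \<delta>_def space_density by (rule emeasure_density_const) (rule sets.top)
      also have "\<dots> \<noteq> \<infinity>"
        using prob_space.emeasure_space_1[OF prob_space_return[OF tR]] by simp
      finally show "emeasure (\<delta> c) (space (\<delta> c)) \<noteq> \<infinity>" .
    qed
  qed (simp add: \<delta>_def)
  have int: "(\<integral>s. U s \<omega> \<partial>\<delta> c) = c * U t \<omega>" if "\<omega> \<in> space N" "c \<ge> 0" for c \<omega>
  proof -
    have m: "(\<lambda>s. U s \<omega>) \<in> borel_measurable ?R"
      by (rule borel_measurable_continuous_on_restrict[OF U_continuous[OF that(1)]])
    then have "(\<integral>s. U s \<omega> \<partial>\<delta> c) = (\<integral>s. c * U s \<omega> \<partial>return ?R t)"
      unfolding \<delta>_def using \<open>c \<ge> 0\<close> by (subst integral_real_density) auto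
    also have "\<dots> = c * U t \<omega>" using m tR by (subst integral_return) auto
    finally show ?thesis .
  qed
  have "expectation (\<lambda>\<omega>. (l * U t \<omega> - signed_integral (\<delta> (max l 0)) (\<delta> (max (- l) 0)) U \<omega>)\<^sup>2) = 0"
  proof -
    have "l * U t \<omega> - signed_integral (\<delta> (max l 0)) (\<delta> (max (- l) 0)) U \<omega> = 0" if "\<omega> \<in> space N" for \<omega>
      using that by (simp add: signed_integral_def int max_def algebra_simps)
    then show ?thesis by (simp cong: Bochner_Integration.integral_cong)
  qed
  then have "\<exists>\<mu> \<nu>. finite_measure_on T \<mu> \<and> finite_measure_on T \<nu>
      \<and> expectation (\<lambda>\<omega>. (l * U t \<omega> - signed_integral \<mu> \<nu> U \<omega>)\<^sup>2) < \<epsilon>" if "\<epsilon> > 0" for \<epsilon>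
    using fin that by (metis)
  then show ?thesis
    using t U_square_integrable[OF t] by (auto simp: gaussian_H_def power_mult_distrib)
qed

text \<open>The function \<open>l * k \<sqdot> t\<close> is represented by the variable \<open>l * U t\<close>, whose second moment is \<open>l\<^sup>2 * k t t\<close>.\<close>

lemma gaussian_rate_kernel_section:
  assumes k: "is_covariance_of k N T U" and t: "t \<in> {0..T}"
  shows "gaussian_rate N T U (\<lambda>s\<in>{0..T}. l * k s t) = ereal (1/2 * l\<^sup>2 * k t t)"
    and "continuous_on {0..T} (\<lambda>s. l * k s t)"
proof -
  have map: "rkhs_map N T U (\<lambda>\<omega>. l * U t \<omega>) = (\<lambda>s\<in>{0..T}. l * k s t)"
    using k t by (auto simp: rkhs_map_def is_covariance_of_def fun_eq_iff mult.left_commute)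
  have "expectation (\<lambda>\<omega>. (l * U t \<omega>)\<^sup>2) = l\<^sup>2 * k t t"
    using k t by (simp only: power_mult_distrib Bochner_Integration.integral_mult_right_zero)
      (simp add: is_covariance_of_def power2_eq_square)
  then show "gaussian_rate N T U (\<lambda>s\<in>{0..T}. l * k s t) = ereal (1/2 * l\<^sup>2 * k t t)"
    using gaussian_rate_rkhs_map[OF scaled_evaluation_in_H[OF t, of l]] by (simp add: map)
  have "continuous_on {0..T} (\<lambda>s. l * expectation (\<lambda>\<omega>. U s \<omega> * U t \<omega>))"
    using t by (intro continuous_on_mult_left covariance_with_continuous U_square_integrable) auto
  then show "continuous_on {0..T} (\<lambda>s. l * k s t)"
    by (rule continuous_on_eq) (use k t in \<open>simp add: is_covariance_of_def\<close>)
qed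

end

section \<open>Events on path space\<close>

lemma topspace_C_space:
  "topspace (C_space T) = {f \<in> extensional {0..T}. continuous_on {0..T} f}"
proof -
  have "compactin (top_of_set {0..T}) (topspace (top_of_set {0..T}))"
    by (simp add: compactin_subtopology)
  from compactin_mspace_cfunspace[OF this, of euclidean_metric] show ?thesis
    unfolding C_space_def topspace_mtopology_of by auto
qed

lemma openin_C_spaceI:
  fixes G :: "(real \<Rightarrow> 'b::real_normed_vector) set"
  assumes sub: "G \<subseteq> topspace (C_space T)"
    and nbhd: "\<And>f. f \<in> G \<Longrightarrow> \<exists>r>0. \<forall>g\<in>topspace (C_space T).
      (\<forall>t\<in>{0..T}. dist (f t) (g t) < r) \<longrightarrow> g \<in> G"
  shows "openin (C_space T) G"
proof -
  define m where "m = cfunspace (top_of_set {0..T}) (euclidean_metric :: 'b metric)"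
  interpret Metric_space "mspace m" "mdist m" by (rule Metric_space_mspace_mdist)
  have C: "C_space T = mtopology" by (simp add: C_space_def m_def mtopology_of_def)
  have sp: "topspace (C_space T) = mspace m" by (simp add: C)
  have cpt: "compactin (top_of_set {0..T}) (topspace (top_of_set {0..T}))"
    by (simp add: compactin_subtopology)
  show ?thesis
    unfolding C openin_mtopology
  proof (intro conjI allI impI)
    show "G \<subseteq> mspace m" using sub by (simp add: sp)
    fix f assume f: "f \<in> G"
    from nbhd[OF f] obtain r where "r > 0"
      and r: "\<And>g. g \<in> topspace (C_space T) \<Longrightarrow> (\<forall>t\<in>{0..T}. dist (f t) (g t) < r) \<Longrightarrow> g \<in> G" by blast
    have "mball f r \<subseteq> G"
    proof
      fix g assume g: "g \<in> mball f r"
      then have gm: "f \<in> mspace m" "g \<in> mspace m" "mdist m f g < r" by auto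
      have "\<forall>t\<in>{0..T}. dist (f t) (g t) < r"
        using cfunspace_mdist_lt[OF cpt gm(1,2)[unfolded m_def] gm(3)[unfolded m_def]] by auto
      with gm(2) show "g \<in> G" by (intro r) (simp_all add: sp)
    qed
    with \<open>r > 0\<close> show "\<exists>r>0. mball f r \<subseteq> G" by blast
  qed
qed

lemma openin_C_space_evaluation:
  fixes O' :: "'b::real_normed_vector set"
  assumes "open O'" and t: "t \<in> {0..T}"
  shows "openin (C_space T) {f \<in> topspace (C_space T). f t \<in> O'}"
proof (rule openin_C_spaceI)
  fix f :: "real \<Rightarrow> 'b" assume "f \<in> {f \<in> topspace (C_space T). f t \<in> O'}"
  then have "f t \<in> O'" by simp
  with \<open>open O'\<close> obtain r where "r > 0" "\<And>y. dist (f t) y < r \<Longrightarrow> y \<in> O'"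
    by (metis open_contains_ball mem_ball subsetD)
  with t show "\<exists>r>0. \<forall>g\<in>topspace (C_space T). (\<forall>t\<in>{0..T}. dist (f t) (g t) < r)
      \<longrightarrow> g \<in> {f \<in> topspace (C_space T). f t \<in> O'}" by blast
qed auto

text \<open>A path that stays below the level stays below it by a positive amount, by compactness of \<open>[0, T]\<close>, and
  so does every path that is uniformly close to it.\<close>

lemma closedin_C_space_reaches_level:
  fixes v :: "'p::finite \<Rightarrow> real" and c :: "real \<Rightarrow> real"
  assumes v: "\<And>i. 0 \<le> v i" and c: "continuous_on {0..T} c"
  shows "closedin (C_space T)
    {f \<in> topspace (C_space T). \<exists>t\<in>{0..T}. c t \<le> (\<Sum>i\<in>UNIV. v i * \<bar>(f t :: real^'p) $ i\<bar>)}"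
    (is "closedin _ ?F")
  unfolding closedin_def
proof
  show "openin (C_space T) (topspace (C_space T) - ?F)"
  proof (rule openin_C_spaceI)
    fix f assume f: "f \<in> topspace (C_space T) - ?F"
    define V where "V = (\<Sum>i\<in>UNIV. v i)"
    have "V \<ge> 0" using v by (simp add: V_def sum_nonneg)
    define gap where "gap = (\<lambda>t. c t - (\<Sum>i\<in>UNIV. v i * \<bar>f t $ i\<bar>))"
    have pos: "gap t > 0" if "t \<in> {0..T}" for t using f that by (force simp: gap_def)
    have cont: "continuous_on {0..T} gap"
      unfolding gap_def using f c by (auto simp: topspace_C_space intro!: continuous_intros)
    have "\<exists>e>0. \<forall>t\<in>{0..T}. e \<le> gap t"
    proof (cases "{0..T} = {}")
      case False
      then obtain t0 where "t0 \<in> {0..T}" "\<And>t. t \<in> {0..T} \<Longrightarrow> gap t0 \<le> gap t"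
        using continuous_attains_inf[OF compact_Icc False cont] by blast
      with pos show ?thesis by blast
    next
      case True
      then show ?thesis by (auto intro: exI[of _ 1])
    qed
    then obtain e where "e > 0" and e: "\<And>t. t \<in> {0..T} \<Longrightarrow> e \<le> gap t" by blast
    define r where "r = e / (V + 1)"
    have "r > 0" using \<open>e > 0\<close> \<open>V \<ge> 0\<close> by (simp add: r_def)
    have "g \<in> topspace (C_space T) - ?F"
      if g: "g \<in> topspace (C_space T)" and near: "\<forall>t\<in>{0..T}. dist (f t) (g t) < r" for g
    proof -
      have "(\<Sum>i\<in>UNIV. v i * \<bar>g t $ i\<bar>) < c t" if t: "t \<in> {0..T}" for t
      proof -
        have "(\<Sum>i\<in>UNIV. v i * \<bar>g t $ i\<bar>) \<le> (\<Sum>i\<in>UNIV. v i * \<bar>f t $ i\<bar> + v i * r)"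
        proof (rule sum_mono)
          fix i
          have "\<bar>g t $ i - f t $ i\<bar> \<le> norm (g t - f t)"
            using component_le_norm_cart[of "g t - f t" i] by simp
          also have "\<dots> < r" using near t by (simp add: dist_norm norm_minus_commute)
          finally have "\<bar>g t $ i\<bar> \<le> \<bar>f t $ i\<bar> + r" by linarith
          then have "v i * \<bar>g t $ i\<bar> \<le> v i * (\<bar>f t $ i\<bar> + r)" using v by (intro mult_left_mono)
          then show "v i * \<bar>g t $ i\<bar> \<le> v i * \<bar>f t $ i\<bar> + v i * r" by (simp add: algebra_simps)
        qed
        also have "\<dots> = (\<Sum>i\<in>UNIV. v i * \<bar>f t $ i\<bar>) + V * r"
          by (simp add: sum.distrib V_def sum_distrib_right)
        also have "V * r < e" using \<open>e > 0\<close> \<open>V \<ge> 0\<close> by (simp add: r_def field_simps)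
        finally show ?thesis using e[OF t] by (simp add: gap_def)
      qed
      then show ?thesis using g by (auto simp: not_le)
    qed
    with \<open>r > 0\<close> show "\<exists>r>0. \<forall>g\<in>topspace (C_space T). (\<forall>t\<in>{0..T}. dist (f t) (g t) < r)
        \<longrightarrow> g \<in> topspace (C_space T) - ?F" by blast
  qed auto
qed auto

text \<open>By compactness, a continuous function has a nonnegative value exactly if it exceeds every \<open>- 1 / (n + 1)\<close>
  somewhere, and for this it suffices to look at a countable dense set of times.\<close>

lemma reaches_zero_measurable:
  fixes f :: "real \<Rightarrow> 'a \<Rightarrow> real"
  assumes meas: "\<And>t. t \<in> {0..T} \<Longrightarrow> f t \<in> borel_measurable M"
    and cont: "\<And>\<omega>. \<omega> \<in> space M \<Longrightarrow> continuous_on {0..T} (\<lambda>t. f t \<omega>)"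
  shows "{\<omega>\<in>space M. \<exists>t\<in>{0..T}. 0 \<le> f t \<omega>} \<in> sets M"
proof -
  obtain D :: "real set" where D: "countable D" "D \<subseteq> {0..T}" "{0..T} \<subseteq> closure D" by (rule separable)
  have "{\<omega>\<in>space M. \<exists>t\<in>{0..T}. 0 \<le> f t \<omega>}
      = {\<omega>\<in>space M. \<forall>n. \<exists>t\<in>D. - inverse (real (Suc n)) < f t \<omega>}"
  proof (intro Collect_cong conj_cong refl iffI allI)
    fix \<omega> n assume \<omega>: "\<omega> \<in> space M" and "\<exists>t\<in>{0..T}. 0 \<le> f t \<omega>"
    then obtain t where t: "t \<in> {0..T}" "0 \<le> f t \<omega>" by blast
    then obtain s where s: "\<And>n. s n \<in> D" "s \<longlonglongrightarrow> t"
      using D(3) by (metis closure_sequential subsetD)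
    have sT: "s n \<in> {0..T}" for n using D(2) s(1)[of n] by (rule subsetD)
    have "(\<lambda>n. f (s n) \<omega>) \<longlonglongrightarrow> f t \<omega>"
      by (rule continuous_on_tendsto_compose[OF cont[OF \<omega>] s(2) t(1)])
        (simp add: sT del: atLeastAtMost_iff)
    moreover have "- inverse (real (Suc n)) < f t \<omega>"
      using t(2) by (meson inverse_positive_iff_positive less_le_trans neg_less_0_iff_less of_nat_0_less_iff zero_less_Suc)
    ultimately have "eventually (\<lambda>k. - inverse (real (Suc n)) < f (s k) \<omega>) sequentially"
      by (rule order_tendstoD)
    then obtain k where "- inverse (real (Suc n)) < f (s k) \<omega>"
      by (auto simp: eventually_sequentially)
    then show "\<exists>t\<in>D. - inverse (real (Suc n)) < f t \<omega>" using s(1) by blast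
  next
    fix \<omega> assume \<omega>: "\<omega> \<in> space M" and *: "\<forall>n. \<exists>t\<in>D. - inverse (real (Suc n)) < f t \<omega>"
    have ne: "{0..T} \<noteq> {}" using * D(2) by blast
    obtain t where t: "t \<in> {0..T}" "\<And>s. s \<in> {0..T} \<Longrightarrow> f s \<omega> \<le> f t \<omega>"
      using continuous_attains_sup[OF compact_Icc ne cont[OF \<omega>]] by blast
    have lower: "- inverse (real (Suc n)) \<le> f t \<omega>" for n
    proof -
      obtain s where "s \<in> D" "- inverse (real (Suc n)) < f s \<omega>" using * by blast
      with t(2)[of s] D(2) show ?thesis by auto
    qed
    have "(\<lambda>n. - inverse (real (Suc n))) \<longlonglongrightarrow> - 0"
      by (intro tendsto_minus LIMSEQ_inverse_real_of_nat)
    from LIMSEQ_le_const2[OF this] lower have "0 \<le> f t \<omega>" by auto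
    with t(1) show "\<exists>t\<in>{0..T}. 0 \<le> f t \<omega>" by blast
  qed
  also have "\<dots> \<in> sets M"
  proof -
    have "{\<omega>\<in>space M. - inverse (real (Suc n)) < f t \<omega>} \<in> sets M" if "t \<in> D" for n t
      using meas[OF subsetD[OF D(2) that]] by measurable
    then show ?thesis
      using D(1) by (intro sets.sets_Collect_countable_All sets.sets_Collect_countable_Bex) auto
  qed
  finally show ?thesis .
qed

lemma vec_box_borel:
  assumes "\<And>i. B i \<in> sets borel"
  shows "{y :: real^'p::finite. \<forall>i. y $ i \<in> B i} \<in> sets borel"
proof -
  have "(\<lambda>y :: real^'p. y $ i) \<in> borel_measurable borel" for i
    by (intro borel_measurable_continuous_onI continuous_on_component continuous_on_id)
  then have "(\<lambda>y :: real^'p. y $ i) -` B i \<inter> space borel \<in> sets borel" for i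
    using assms by (rule measurable_sets)
  then have "(\<Inter>i\<in>UNIV. (\<lambda>y :: real^'p. y $ i) -` B i) \<in> sets borel"
    by (intro sets.finite_INT) auto
  also have "(\<Inter>i\<in>UNIV. (\<lambda>y :: real^'p. y $ i) -` B i) = {y. \<forall>i. y $ i \<in> B i}" by auto
  finally show ?thesis .
qed

lemma (in prob_space) prob_box_and_independent_event:
  fixes A :: "'a \<Rightarrow> real^'p::finite"
  assumes comp: "indep_vars (\<lambda>_. borel) (\<lambda>i \<omega>. A \<omega> $ i) UNIV"
    and indep: "indep_set (sets (vimage_algebra (space M) A borel)) \<E>"
    and B: "\<And>i. B i \<in> sets borel" and E: "E \<in> \<E>"
  shows "prob ({\<omega>\<in>space M. \<forall>i. A \<omega> $ i \<in> B i} \<inter> E)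
    = (\<Prod>i\<in>UNIV. prob {\<omega>\<in>space M. A \<omega> $ i \<in> B i}) * prob E"
proof -
  have "{\<omega>\<in>space M. \<forall>i. A \<omega> $ i \<in> B i} = A -` {y. \<forall>i. y $ i \<in> B i} \<inter> space M" by auto
  also have "\<dots> \<in> sets (vimage_algebra (space M) A borel)"
    by (intro in_vimage_algebra vec_box_borel B)
  finally have "prob ({\<omega>\<in>space M. \<forall>i. A \<omega> $ i \<in> B i} \<inter> E)
      = prob {\<omega>\<in>space M. \<forall>i. A \<omega> $ i \<in> B i} * prob E"
    using E by (intro indep_setD[OF indep])
  moreover have "{\<omega>\<in>space M. \<forall>i. A \<omega> $ i \<in> B i} = (\<Inter>i\<in>UNIV. (\<lambda>\<omega>. A \<omega> $ i) -` B i \<inter> space M)"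
    by auto
  moreover have "prob (\<Inter>i\<in>UNIV. (\<lambda>\<omega>. A \<omega> $ i) -` B i \<inter> space M)
      = (\<Prod>i\<in>UNIV. prob ((\<lambda>\<omega>. A \<omega> $ i) -` B i \<inter> space M))"
    by (intro indep_varsD_finite[OF comp]) (use B in auto)
  moreover have "(\<lambda>\<omega>. A \<omega> $ i) -` B i \<inter> space M = {\<omega>\<in>space M. A \<omega> $ i \<in> B i}" for i by auto
  ultimately show ?thesis by simp
qed

section \<open>Randomly scaled Gaussian processes\<close>

text \<open>Uniform continuity of the rate \<open>d * y powr \<theta>\<close> on \<open>[0, R]\<close> makes it almost constant on each cell of a
  sufficiently fine grid.\<close>

lemma power_grid:
  fixes d \<theta> R e :: real
  assumes "\<theta> > 0" "R > 0" "e > 0"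
  shows "\<exists>(m::nat) l u. (\<forall>j. 0 \<le> l j \<and> l j \<le> u j)
    \<and> (\<forall>j<m. d * u j powr \<theta> - d * l j powr \<theta> \<le> e)
    \<and> (\<forall>y. 0 \<le> y \<longrightarrow> y < R \<longrightarrow> (\<exists>j<m. l j \<le> y \<and> y \<le> u j))"
proof -
  have "continuous_on {0..R} (\<lambda>y. d * y powr \<theta>)"
    using \<open>\<theta> > 0\<close>
    by (intro continuous_on_mult_left continuous_on_powr' continuous_on_id continuous_on_const) auto
  then have "uniformly_continuous_on {0..R} (\<lambda>y. d * y powr \<theta>)"
    by (intro compact_uniformly_continuous) auto
  then obtain \<delta> where "\<delta> > 0" and \<delta>: "\<And>y y'. y \<in> {0..R} \<Longrightarrow> y' \<in> {0..R} \<Longrightarrow> dist y' y < \<delta>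
      \<Longrightarrow> dist (d * y' powr \<theta>) (d * y powr \<theta>) < e"
    unfolding uniformly_continuous_on_def using \<open>e > 0\<close> by metis
  obtain m :: nat where m: "R / \<delta> < real m" using reals_Archimedean2 by blast
  have "real m > 0" using m \<open>R > 0\<close> \<open>\<delta> > 0\<close> by (meson divide_pos_pos less_trans)
  define h where "h = R / real m"
  have h: "h > 0" "h < \<delta>" "real m * h = R"
    using m \<open>R > 0\<close> \<open>real m > 0\<close> \<open>\<delta> > 0\<close> by (simp_all add: h_def field_simps)
  define l where "l = (\<lambda>j::nat. real j * h)"
  define u where "u = (\<lambda>j::nat. real (Suc j) * h)"
  have lu: "0 \<le> l j" "u j = l j + h" for j using h by (simp_all add: l_def u_def algebra_simps)
  have "d * u j powr \<theta> - d * l j powr \<theta> \<le> e" if "j < m" for j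
  proof -
    have "u j \<le> real m * h" unfolding u_def using that h by (intro mult_right_mono) auto
    then have "dist (d * u j powr \<theta>) (d * l j powr \<theta>) < e"
      using lu[of j] h by (intro \<delta>) (auto simp: dist_real_def)
    then show ?thesis by (simp add: dist_real_def)
  qed
  moreover have "\<exists>j<m. l j \<le> y \<and> y \<le> u j" if y: "0 \<le> y" "y < R" for y
  proof (intro exI conjI)
    define j where "j = nat \<lfloor>y / h\<rfloor>"
    have "0 \<le> y / h" using y h by simp
    then have j: "real j = of_int \<lfloor>y / h\<rfloor>" by (simp add: j_def)
    have "y / h < real m" using y h by (simp add: field_simps)
    with j show "j < m" by linarith
    have "real j \<le> y / h" "y / h \<le> real (Suc j)" using j by (simp, simp, linarith)
    with h show "l j \<le> y" "y \<le> u j" by (simp_all add: l_def u_def field_simps)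
  qed
  moreover have "0 \<le> l j \<and> l j \<le> u j" for j using lu[of j] h by simp
  ultimately show ?thesis by blast
qed

locale scaled_gaussian_LDP = prob_space M for M :: "'a measure" +
  fixes N :: "'p::finite \<Rightarrow> 'b measure"
    and U :: "'p \<Rightarrow> real \<Rightarrow> 'b \<Rightarrow> real"
    and k :: "'p \<Rightarrow> real \<Rightarrow> real \<Rightarrow> real"
    and X :: "nat \<Rightarrow> real \<Rightarrow> 'a \<Rightarrow> real^'p"
    and A :: "nat \<Rightarrow> 'a \<Rightarrow> real^'p"
    and b :: "real \<Rightarrow> real^'p"
    and \<xi> :: "real^'p"
    and \<gamma> :: "nat \<Rightarrow> real"
    and T d \<theta> x :: real
  assumes \<gamma>: "speed \<gamma>"
    and gp: "\<And>i. gaussian_process (N i) T (U i)"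
    and cov: "\<And>i. is_covariance_of (k i) (N i) T (U i)"
    and X_process: "\<And>n. continuous_centered_gaussian_process M T (X n)"
    and X_LDP: "satisfies_LDP_rv (C_space T) M (\<lambda>n \<omega>. \<lambda>t\<in>{0..T}. X n t \<omega>)
           (\<lambda>h. \<Sum>i\<in>UNIV. gaussian_rate (N i) T (U i) (\<lambda>t\<in>{0..T}. h t $ i)) \<gamma>"
    and d_pos: "d > 0" and \<theta>_gt: "\<theta> > 2"
    and A_measurable: "\<And>n. A n \<in> borel_measurable M"
    and A_pos: "\<And>n i \<omega>. \<omega> \<in> space M \<Longrightarrow> A n \<omega> $ i > 0"
    and A_indep: "\<And>n. indep_vars (\<lambda>_. borel) (\<lambda>i \<omega>. A n \<omega> $ i) UNIV"
    and AX_indep: "\<And>n. indep_set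
               (sets (vimage_algebra (space M) (A n) borel))
               (sets (vimage_algebra (space M) (\<lambda>\<omega>. \<lambda>t\<in>{0..T}. X n t \<omega>)
                        (PiM {0..T} (\<lambda>_. borel))))"
    and A_LDP: "\<And>i. satisfies_LDP_rv (top_of_set {0..}) M (\<lambda>n \<omega>. A n \<omega> $ i)
               (\<lambda>y::real. ereal (d * y powr \<theta>)) \<gamma>"
    and b_cont: "continuous_on {0..T} b"
    and \<xi>_nonneg: "\<And>i. \<xi> $ i \<ge> 0"
    and above: "\<And>t. t \<in> {0..T} \<Longrightarrow> x - b t \<bullet> \<xi> > 0"
begin

definition gap :: "real \<Rightarrow> real" where
  "gap t = - (b t \<bullet> \<xi>) + x"

text \<open>The events that depend on the path of \<open>X n\<close> only; these are the ones independent of \<open>A n\<close>.\<close>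

definition path_algebra :: "nat \<Rightarrow> 'a measure" where
  "path_algebra n = vimage_algebra (space M) (\<lambda>\<omega>. \<lambda>t\<in>{0..T}. X n t \<omega>) (PiM {0..T} (\<lambda>_. borel))"

definition rate :: "(real \<Rightarrow> real^'p) \<Rightarrow> ereal" where
  "rate h = (\<Sum>i\<in>UNIV. gaussian_rate (N i) T (U i) (\<lambda>t\<in>{0..T}. h t $ i))"

text \<open>As paths are continuous on the compact interval, this is the event that the supremum of \<open>Z n t \<bullet> \<xi>\<close> is
  at least \<open>x\<close>.\<close>

definition exceedance :: "nat \<Rightarrow> 'a set" where
  "exceedance n = {\<omega>\<in>space M. \<exists>t\<in>{0..T}. gap t \<le> (\<Sum>i\<in>UNIV. A n \<omega> $ i * \<xi> $ i * X n t \<omega> $ i)}"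

abbreviation cost :: "real \<Rightarrow> ereal" where
  "cost t \<equiv> pointwise_cost d \<theta> \<xi> (\<lambda>j. k j t t) (gap t)"

lemma gap_pos: "t \<in> {0..T} \<Longrightarrow> gap t > 0"
  using above by (simp add: gap_def)

lemma gap_continuous: "continuous_on {0..T} gap"
  unfolding gap_def by (intro continuous_intros b_cont)

lemma k_diag: "t \<in> {0..T} \<Longrightarrow> k i t t = (\<integral>\<omega>. (U i t \<omega>)\<^sup>2 \<partial>N i)"
  using cov[of i] by (simp add: is_covariance_of_def power2_eq_square)

lemma k_nonneg: "t \<in> {0..T} \<Longrightarrow> k i t t \<ge> 0"
  by (simp add: k_diag)

lemma X_continuous: "\<omega> \<in> space M \<Longrightarrow> continuous_on {0..T} (\<lambda>t. X n t \<omega>)"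
  using X_process by (simp add: continuous_centered_gaussian_process_def)

lemma X_measurable: "t \<in> {0..T} \<Longrightarrow> X n t \<in> borel_measurable M"
  using X_process by (simp add: continuous_centered_gaussian_process_def)

lemma path_in_C_space:
  "\<omega> \<in> space M \<Longrightarrow> (\<lambda>t\<in>{0..T}. X n t \<omega>) \<in> topspace (C_space T)"
  by (auto simp: topspace_C_space intro: continuous_on_eq[OF X_continuous])

lemma space_path_algebra [simp]: "space (path_algebra n) = space M"
  by (simp add: path_algebra_def)

lemma X_path_measurable:
  assumes "t \<in> {0..T}"
  shows "X n t \<in> borel_measurable (path_algebra n)"
proof -
  have "(\<lambda>\<omega>. \<lambda>t\<in>{0..T}. X n t \<omega>) \<in> measurable (path_algebra n) (PiM {0..T} (\<lambda>_. borel))"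
    unfolding path_algebra_def
    by (rule measurable_vimage_algebra1) (auto simp: space_PiM)
  from measurable_compose[OF this measurable_component_singleton[OF assms]] assms show ?thesis by simp
qed

text \<open>The absolute values anticipate the upper bound, where the scaling factors are replaced by larger
  ones: \<open>u i * \<bar>h t $ i\<bar>\<close> is monotone in \<open>u i\<close>, but \<open>u i * h t $ i\<close> is so only if \<open>h t $ i \<ge> 0\<close>.\<close>

lemma cost_le_energy:
  assumes t: "t \<in> {0..T}" and u: "\<And>i. u i \<ge> 0"
    and reach: "gap t \<le> (\<Sum>i\<in>UNIV. u i * \<xi> $ i * \<bar>h t $ i\<bar>)"
  shows "cost t \<le> ereal (\<Sum>i\<in>UNIV. d * u i powr \<theta>) + rate h"
proof (cases "rate h = \<infinity>")
  case False
  have "\<exists>J. gaussian_rate (N i) T (U i) (\<lambda>t\<in>{0..T}. h t $ i) = ereal J" for i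
  proof -
    have "gaussian_rate (N i) T (U i) (\<lambda>t\<in>{0..T}. h t $ i) \<noteq> \<infinity>"
      using False by (auto simp: rate_def sum_Pinfty)
    then show ?thesis
      using gaussian_process.gaussian_rate_nonneg[OF gp, of i "\<lambda>t\<in>{0..T}. h t $ i"]
      by (cases "gaussian_rate (N i) T (U i) (\<lambda>t\<in>{0..T}. h t $ i)") auto
  qed
  then obtain J where J: "\<And>i. gaussian_rate (N i) T (U i) (\<lambda>t\<in>{0..T}. h t $ i) = ereal (J i)" by metis
  have J0: "J i \<ge> 0" for i
    using gaussian_process.gaussian_rate_nonneg[OF gp, of i "\<lambda>t\<in>{0..T}. h t $ i"] by (simp add: J)
  have ev: "\<bar>h t $ i\<bar>\<^sup>2 \<le> 2 * J i * k i t t" for i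
    using gaussian_process.gaussian_rate_evaluation_bound[OF gp J t] t by (simp add: k_diag)
  note lb = cost_lower_bound[where \<xi> = \<xi> and v = "\<lambda>i. k i t t" and a = u and J = J
      and \<eta> = "\<lambda>i. \<bar>h t $ i\<bar>", OF d_pos \<theta>_gt gap_pos[OF t] \<xi>_nonneg k_nonneg[OF t] u J0 ev reach]
  have "rate h = ereal (\<Sum>i\<in>UNIV. J i)" by (simp add: rate_def J)
  then show ?thesis
    using lb by (simp add: pointwise_cost_eq[OF d_pos \<theta>_gt gap_pos[OF t]] sum_distrib_left)
qed simp

text \<open>The optimal pair for the level \<open>gap t\<close> only reaches it, while the lower bound needs an open condition.
  The optimal pair for a slightly higher level exceeds \<open>gap t\<close>, and its cost is still below \<open>C\<close>, as
  the cost is continuous in the level.\<close>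

lemma energy_below:
  assumes t: "t \<in> {0..T}" and C: "cost t < ereal C"
  shows "\<exists>a h. (\<forall>i. a i \<ge> 0) \<and> h \<in> topspace (C_space T)
    \<and> gap t < (\<Sum>i\<in>UNIV. a i * \<xi> $ i * h t $ i)
    \<and> ereal (\<Sum>i\<in>UNIV. d * a i powr \<theta>) + rate h < ereal C"
proof -
  define S where "S = dual_variance \<theta> \<xi> (\<lambda>j. k j t t)"
  have "S > 0" and low: "\<psi> d \<theta> * (1/2 * ((gap t)\<^sup>2 / S)) powr (\<theta> / (\<theta> + 2)) < C"
    using C pointwise_cost_eq[OF d_pos \<theta>_gt gap_pos[OF t], of \<xi> "\<lambda>j. k j t t"]
    by (auto simp: S_def split: if_splits)
  have "eventually (\<lambda>c. \<psi> d \<theta> * (1/2 * (c\<^sup>2 / S)) powr (\<theta> / (\<theta> + 2)) < C) (at_right (gap t))"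
  proof (rule order_tendstoD(2)[OF _ low])
    show "((\<lambda>c. \<psi> d \<theta> * (1/2 * (c\<^sup>2 / S)) powr (\<theta> / (\<theta> + 2)))
        \<longlongrightarrow> \<psi> d \<theta> * (1/2 * ((gap t)\<^sup>2 / S)) powr (\<theta> / (\<theta> + 2))) (at_right (gap t))"
      using \<open>S > 0\<close> gap_pos[OF t] by (intro tendsto_intros) auto
  qed
  moreover have "eventually (\<lambda>c. gap t < c) (at_right (gap t))" by (rule eventually_at_right_less)
  ultimately have "eventually (\<lambda>c. gap t < c \<and>
      \<psi> d \<theta> * (1/2 * (c\<^sup>2 / S)) powr (\<theta> / (\<theta> + 2)) < C) (at_right (gap t))"
    by eventually_elim simp
  then obtain c where c: "gap t < c" "\<psi> d \<theta> * (1/2 * (c\<^sup>2 / S)) powr (\<theta> / (\<theta> + 2)) < C"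
    using eventually_happens[of _ "at_right (gap t)"] by (auto simp: trivial_limit_at_right_real)
  have "c > 0" using c(1) gap_pos[OF t] by simp
  obtain a l where a: "\<And>i. a i \<ge> 0"
    and level: "(\<Sum>i\<in>UNIV. a i * (\<xi> $ i) * (l i * k i t t)) = c"
    and energy: "d * (\<Sum>i\<in>UNIV. a i powr \<theta>) + (\<Sum>i\<in>UNIV. 1/2 * (l i)\<^sup>2 * k i t t)
      = \<psi> d \<theta> * (1/2 * (c\<^sup>2 / S)) powr (\<theta> / (\<theta> + 2))"
    using cost_attained[where \<xi> = \<xi> and v = "\<lambda>j. k j t t", OF d_pos \<theta>_gt \<open>c > 0\<close> \<xi>_nonneg k_nonneg[OF t]]
      \<open>S > 0\<close> unfolding S_def by blast
  define h where "h = (\<lambda>s\<in>{0..T}. \<chi> i. l i * k i s t)"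
  note kernel = gaussian_process.gaussian_rate_kernel_section[OF gp cov t]
  have hi: "(\<lambda>s\<in>{0..T}. h s $ i) = (\<lambda>s\<in>{0..T}. l i * k i s t)" for i
    by (auto simp: h_def fun_eq_iff)
  have rate: "rate h = ereal (\<Sum>i\<in>UNIV. 1/2 * (l i)\<^sup>2 * k i t t)"
    by (simp add: rate_def hi kernel(1))
  have "continuous_on {0..T} (\<lambda>s. \<chi> i. l i * k i s t)"
    using kernel(2) by (intro continuous_on_vec_lambda)
  then have "continuous_on {0..T} h" by (rule continuous_on_eq) (simp add: h_def)
  then have 1: "h \<in> topspace (C_space T)"
    by (simp add: topspace_C_space) (simp add: h_def)
  have "h t $ i = l i * k i t t" for i using t by (simp add: h_def)
  then have 2: "gap t < (\<Sum>i\<in>UNIV. a i * \<xi> $ i * h t $ i)" using level c(1) by simp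
  have 3: "ereal (\<Sum>i\<in>UNIV. d * a i powr \<theta>) + rate h < ereal C"
    using energy c(2) by (simp add: rate flip: sum_distrib_left)
  from a 1 2 3 show ?thesis by blast
qed

lemma A_in_half_line: "\<omega> \<in> space M \<Longrightarrow> A n \<omega> $ i \<in> topspace (top_of_set {0..})"
  using A_pos by (simp add: less_imp_le)

lemma A_upper:
  assumes "closed B" and v: "\<And>y. y \<in> B \<Longrightarrow> 0 \<le> y \<Longrightarrow> v \<le> d * y powr \<theta>" and "v' < v"
  shows "eventually (\<lambda>n. prob {\<omega>\<in>space M. A n \<omega> $ i \<in> B} \<le> exp (- \<gamma> n * v')) sequentially"
proof -
  have cl: "closedin (top_of_set {0..}) ({0..} \<inter> B)" using \<open>closed B\<close> by (rule closedin_closed_Int)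
  have "ereal v \<le> (INF y\<in>{0..} \<inter> B. ereal (d * y powr \<theta>))" using v by (intro INF_greatest) auto
  then have "ereal v' < (INF y\<in>{0..} \<inter> B. ereal (d * y powr \<theta>))"
    using \<open>v' < v\<close> by (meson ereal_less_eq(3) less_ereal.simps(1) less_le_trans)
  from LDP_rv_upper[OF A_LDP A_in_half_line cl this]
  have "eventually (\<lambda>n. prob ((\<lambda>\<omega>. A n \<omega> $ i) -` ({0..} \<inter> B) \<inter> space M) \<le> exp (- \<gamma> n * v')) sequentially" .
  moreover have "(\<lambda>\<omega>. A n \<omega> $ i) -` ({0..} \<inter> B) \<inter> space M = {\<omega>\<in>space M. A n \<omega> $ i \<in> B}" for n
    using A_in_half_line by auto
  ultimately show ?thesis by simp
qed

lemma A_lower: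
  assumes "open B" "y \<in> B" "0 \<le> y" "d * y powr \<theta> < v"
  shows "eventually (\<lambda>n. exp (- \<gamma> n * v) \<le> prob {\<omega>\<in>space M. A n \<omega> $ i \<in> B}) sequentially"
proof -
  have op: "openin (top_of_set {0..}) ({0..} \<inter> B)" using \<open>open B\<close> by (rule openin_open_Int)
  have y: "y \<in> {0..} \<inter> B" "ereal (d * y powr \<theta>) < ereal v" using assms by auto
  from LDP_rv_lower[OF A_LDP A_in_half_line op y]
  have "eventually (\<lambda>n. exp (- \<gamma> n * v) \<le> prob ((\<lambda>\<omega>. A n \<omega> $ i) -` ({0..} \<inter> B) \<inter> space M)) sequentially" .
  moreover have "(\<lambda>\<omega>. A n \<omega> $ i) -` ({0..} \<inter> B) \<inter> space M = {\<omega>\<in>space M. A n \<omega> $ i \<in> B}" for n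
    using A_in_half_line by auto
  ultimately show ?thesis by simp
qed

lemma exceedance_measurable: "exceedance n \<in> sets M"
proof -
  have "A n \<in> borel_measurable M" by (rule A_measurable)
  then have [measurable]: "(\<lambda>\<omega>. A n \<omega> $ i) \<in> borel_measurable M" for i
    by (rule measurable_compose) (intro borel_measurable_continuous_onI continuous_on_component continuous_on_id)
  have X: "(\<lambda>\<omega>. X n t \<omega> $ i) \<in> borel_measurable M" if "t \<in> {0..T}" for t i
    by (rule measurable_compose[OF X_measurable[OF that]])
      (intro borel_measurable_continuous_onI continuous_on_component continuous_on_id)
  have "{\<omega>\<in>space M. \<exists>t\<in>{0..T}. 0 \<le> (\<Sum>i\<in>UNIV. A n \<omega> $ i * \<xi> $ i * X n t \<omega> $ i) - gap t} \<in> sets M"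
  proof (rule reaches_zero_measurable)
    fix t assume "t \<in> {0..T}"
    note [measurable] = X[OF this]
    show "(\<lambda>\<omega>. (\<Sum>i\<in>UNIV. A n \<omega> $ i * \<xi> $ i * X n t \<omega> $ i) - gap t) \<in> borel_measurable M" by measurable
  qed (intro continuous_intros X_continuous gap_continuous)
  then show ?thesis by (simp add: exceedance_def)
qed

lemma level_event_in_path_algebra:
  "{\<omega>\<in>space M. \<exists>t\<in>{0..T}. gap t \<le> (\<Sum>i\<in>UNIV. v i * \<bar>X n t \<omega> $ i\<bar>)} \<in> sets (path_algebra n)"
proof -
  have X: "(\<lambda>\<omega>. X n t \<omega> $ i) \<in> borel_measurable (path_algebra n)" if "t \<in> {0..T}" for t i
    by (rule measurable_compose[OF X_path_measurable[OF that]])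
      (intro borel_measurable_continuous_onI continuous_on_component continuous_on_id)
  have "{\<omega>\<in>space (path_algebra n). \<exists>t\<in>{0..T}. 0 \<le> (\<Sum>i\<in>UNIV. v i * \<bar>X n t \<omega> $ i\<bar>) - gap t}
      \<in> sets (path_algebra n)"
  proof (rule reaches_zero_measurable)
    fix t assume "t \<in> {0..T}"
    note [measurable] = X[OF this]
    show "(\<lambda>\<omega>. (\<Sum>i\<in>UNIV. v i * \<bar>X n t \<omega> $ i\<bar>) - gap t) \<in> borel_measurable (path_algebra n)"
      by measurable
  next
    fix \<omega> assume "\<omega> \<in> space (path_algebra n)"
    then have "\<omega> \<in> space M" by simp
    then show "continuous_on {0..T} (\<lambda>t. (\<Sum>i\<in>UNIV. v i * \<bar>X n t \<omega> $ i\<bar>) - gap t)"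
      by (intro continuous_intros X_continuous gap_continuous)
  qed
  then show ?thesis by simp
qed

text \<open>For a fixed scaling \<open>u\<close> every path that reaches the level costs at least \<open>w' - (\<Sum>i. d * u i powr \<theta>)\<close>, by
  \<open>cost_le_energy\<close>.\<close>

lemma X_upper:
  assumes u: "\<And>i. u i \<ge> 0"
    and low: "\<And>t. t \<in> {0..T} \<Longrightarrow> ereal w' \<le> cost t" and "w'' < w'"
  shows "eventually (\<lambda>n. prob {\<omega>\<in>space M. \<exists>t\<in>{0..T}. gap t \<le> (\<Sum>i\<in>UNIV. (u i * \<xi> $ i) * \<bar>X n t \<omega> $ i\<bar>)}
    \<le> exp (- \<gamma> n * (w'' - (\<Sum>i\<in>UNIV. d * u i powr \<theta>)))) sequentially"
proof -
  define F where "F = {f \<in> topspace (C_space T).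
    \<exists>t\<in>{0..T}. gap t \<le> (\<Sum>i\<in>UNIV. (u i * \<xi> $ i) * \<bar>(f t :: real^'p) $ i\<bar>)}"
  define D where "D = (\<Sum>i\<in>UNIV. d * u i powr \<theta>)"
  have cl: "closedin (C_space T) F"
    unfolding F_def using u \<xi>_nonneg gap_continuous by (intro closedin_C_space_reaches_level) auto
  have "ereal (w' - D) \<le> (INF h\<in>F. rate h)"
  proof (rule INF_greatest)
    fix h assume "h \<in> F"
    then obtain t where t: "t \<in> {0..T}" "gap t \<le> (\<Sum>i\<in>UNIV. u i * \<xi> $ i * \<bar>h t $ i\<bar>)"
      by (auto simp: F_def)
    have "ereal w' \<le> ereal D + rate h"
      using low[OF t(1)] cost_le_energy[where u = u and h = h, OF t(1) u t(2)] by (auto simp: D_def intro: order_trans)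
    then show "ereal (w' - D) \<le> rate h" by (cases "rate h") auto
  qed
  then have "ereal (w'' - D) < (INF h\<in>F. rate h)"
    using \<open>w'' < w'\<close> by (meson diff_strict_right_mono less_ereal.simps(1) less_le_trans)
  from LDP_rv_upper[OF X_LDP path_in_C_space cl this[unfolded rate_def]]
  have "eventually (\<lambda>n. prob ((\<lambda>\<omega>. \<lambda>t\<in>{0..T}. X n t \<omega>) -` F \<inter> space M) \<le> exp (- \<gamma> n * (w'' - D))) sequentially" .
  moreover have "(\<lambda>\<omega>. \<lambda>t\<in>{0..T}. X n t \<omega>) -` F \<inter> space M
      = {\<omega>\<in>space M. \<exists>t\<in>{0..T}. gap t \<le> (\<Sum>i\<in>UNIV. (u i * \<xi> $ i) * \<bar>X n t \<omega> $ i\<bar>)}" for n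
    using path_in_C_space by (auto simp: F_def)
  ultimately show ?thesis by (simp add: D_def)
qed

text \<open>Either some factor is at least \<open>R\<close>, which already costs more than \<open>C\<close>, or \<open>A n\<close> lies in one of finitely many
  boxes.  For a box with lower corner \<open>l\<close> and upper corner \<open>u\<close> the costs \<open>\<Sum>i. d * l i powr \<theta>\<close> and
  \<open>w' - (\<Sum>i. d * u i powr \<theta>)\<close> add up to almost \<open>w'\<close>.\<close>

lemma exceedance_upper:
  assumes low: "\<And>t. t \<in> {0..T} \<Longrightarrow> ereal w' \<le> cost t" and "C < w'"
  shows "eventually (\<lambda>n. prob (exceedance n) \<le> exp (- \<gamma> n * C)) sequentially"
proof -
  obtain C2 where C2: "C < C2" "C2 < w'" using dense[OF \<open>C < w'\<close>] by blast
  obtain C1 where C1: "C < C1" "C1 < C2" using dense[OF C2(1)] by blast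
  define P where "P = real CARD('p)"
  have "P > 0" by (simp add: P_def)
  \<comment> \<open>The distance from \<open>C2\<close> to \<open>C1\<close> pays, for each coordinate, once for the oscillation of the rate over a
    cell and once for the strict inequality in \<open>A_upper\<close>.\<close>
  define e where "e = (C2 - C1) / (2 * P)"
  have "e > 0" using \<open>P > 0\<close> C1 by (simp add: e_def)
  \<comment> \<open>The cost of a factor \<open>R\<close> is \<open>d * R powr \<theta> = \<bar>C1\<bar> + d\<close>.\<close>
  define R where "R = (\<bar>C1\<bar> / d + 1) powr (1 / \<theta>)"
  have "0 \<le> \<bar>C1\<bar> / d" using d_pos by simp
  then have "0 < \<bar>C1\<bar> / d + 1" by linarith
  then have "R > 0" by (simp add: R_def)
  have "R powr \<theta> = \<bar>C1\<bar> / d + 1"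
    using \<theta>_gt \<open>0 < \<bar>C1\<bar> / d + 1\<close> by (simp add: R_def powr_powr)
  then have "d * R powr \<theta> = \<bar>C1\<bar> + d" using d_pos by (simp add: field_simps)
  then have R: "C1 < d * R powr \<theta>" using d_pos by simp
  have "\<theta> > 0" using \<theta>_gt by simp
  from power_grid[OF this \<open>R > 0\<close> \<open>e > 0\<close>, of d] obtain m :: nat and l u
    where "\<forall>j. 0 \<le> l j \<and> l j \<le> u j"
      and osc: "\<forall>j<m. d * u j powr \<theta> - d * l j powr \<theta> \<le> e"
      and grid: "\<forall>y. 0 \<le> y \<longrightarrow> y < R \<longrightarrow> (\<exists>j<m. l j \<le> y \<and> y \<le> u j)" by blast
  then have lu: "0 \<le> l j" "l j \<le> u j" "0 \<le> u j" for j by (auto intro: order_trans)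
  define cells where "cells = (PiE UNIV (\<lambda>_. {..<m}) :: ('p \<Rightarrow> nat) set)"
  have fin: "finite cells" unfolding cells_def by (intro finite_PiE) auto
  define tail where "tail = (\<lambda>n i. {\<omega>\<in>space M. A n \<omega> $ i \<in> {R..}})"
  define level where "level = (\<lambda>n (j :: 'p \<Rightarrow> nat). {\<omega>\<in>space M. \<exists>t\<in>{0..T}.
    gap t \<le> (\<Sum>i\<in>UNIV. (u (j i) * \<xi> $ i) * \<bar>X n t \<omega> $ i\<bar>)})"
  define cell where "cell = (\<lambda>n (j :: 'p \<Rightarrow> nat).
    {\<omega>\<in>space M. \<forall>i. A n \<omega> $ i \<in> {l (j i)..u (j i)}} \<inter> level n j)"
  define part where "part = (\<lambda>n. case_sum (tail n) (cell n))"
  define parts where "parts = (UNIV :: 'p set) <+> cells"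
  have "finite parts" unfolding parts_def using fin by (intro finite_Plus) auto
  have cell_eq: "prob (cell n j) = (\<Prod>i\<in>UNIV. prob {\<omega>\<in>space M. A n \<omega> $ i \<in> {l (j i)..u (j i)}}) * prob (level n j)"
    for n j
    unfolding cell_def level_def
    by (rule prob_box_and_independent_event[OF A_indep AX_indep])
      (use level_event_in_path_algebra in \<open>auto simp: path_algebra_def\<close>)
  have A_comp: "(\<lambda>\<omega>. A n \<omega> $ i) \<in> borel_measurable M" for n i
    by (rule measurable_compose[OF A_measurable])
      (intro borel_measurable_continuous_onI continuous_on_component continuous_on_id)
  have level_M: "level n j \<in> sets M" for n j
  proof -
    have "level n j \<in> sets (path_algebra n)"
      unfolding level_def by (rule level_event_in_path_algebra)
    then show ?thesis
      using indep_setD_ev2[OF AX_indep] by (auto simp: path_algebra_def)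
  qed
  have parts_M: "part n s \<in> sets M" for n s
  proof (cases s)
    case (Inl i)
    then show ?thesis using measurable_sets[OF A_comp, of "{R..}" n i]
      by (simp add: part_def tail_def vimage_def Int_def conj_commute)
  next
    case (Inr j)
    have "A n -` {y. \<forall>i. y $ i \<in> {l (j i)..u (j i)}} \<inter> space M \<in> sets M"
      by (intro measurable_sets[OF A_measurable] vec_box_borel) simp
    moreover have "A n -` {y. \<forall>i. y $ i \<in> {l (j i)..u (j i)}} \<inter> space M
        = {\<omega>\<in>space M. \<forall>i. A n \<omega> $ i \<in> {l (j i)..u (j i)}}" by auto
    ultimately have "{\<omega>\<in>space M. \<forall>i. A n \<omega> $ i \<in> {l (j i)..u (j i)}} \<in> sets M" by simp
    then show ?thesis using level_M Inr by (auto simp: part_def cell_def)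
  qed
  \<comment> \<open>Exceedance with all factors below \<open>R\<close> puts \<open>A n\<close> into some cell, and replacing it by the upper corner
    of the cell leaves an event of \<open>X n\<close> alone.\<close>
  have cover: "exceedance n \<subseteq> (\<Union>s\<in>parts. part n s)" for n
  proof
    fix \<omega> assume "\<omega> \<in> exceedance n"
    then obtain t where \<omega>: "\<omega> \<in> space M" and t: "t \<in> {0..T}"
      and reach: "gap t \<le> (\<Sum>i\<in>UNIV. A n \<omega> $ i * \<xi> $ i * X n t \<omega> $ i)"
      by (auto simp: exceedance_def)
    show "\<omega> \<in> (\<Union>s\<in>parts. part n s)"
    proof (cases "\<exists>i. R \<le> A n \<omega> $ i")
      case True
      then obtain i where "R \<le> A n \<omega> $ i" by blast
      then have "\<omega> \<in> part n (Inl i)" using \<omega> by (simp add: part_def tail_def)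
      moreover have "Inl i \<in> parts" unfolding parts_def by (intro InlI) simp
      ultimately show ?thesis by blast
    next
      case False
      then have "\<exists>j<m. l j \<le> A n \<omega> $ i \<and> A n \<omega> $ i \<le> u j" for i
        using grid A_pos[OF \<omega>, of n i] by (simp add: not_le)
      then obtain j where j: "\<And>i. j i < m" "\<And>i. l (j i) \<le> A n \<omega> $ i" "\<And>i. A n \<omega> $ i \<le> u (j i)"
        by metis
      have "A n \<omega> $ i * \<xi> $ i * X n t \<omega> $ i \<le> (u (j i) * \<xi> $ i) * \<bar>X n t \<omega> $ i\<bar>" for i
      proof -
        have "A n \<omega> $ i * \<xi> $ i * X n t \<omega> $ i \<le> A n \<omega> $ i * \<xi> $ i * \<bar>X n t \<omega> $ i\<bar>"
          using A_pos[OF \<omega>, of n i] \<xi>_nonneg[of i] by (intro mult_left_mono) auto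
        also have "\<dots> \<le> u (j i) * \<xi> $ i * \<bar>X n t \<omega> $ i\<bar>"
          using j(3)[of i] \<xi>_nonneg[of i] by (intro mult_right_mono) auto
        finally show ?thesis .
      qed
      then have "(\<Sum>i\<in>UNIV. A n \<omega> $ i * \<xi> $ i * X n t \<omega> $ i) \<le> (\<Sum>i\<in>UNIV. (u (j i) * \<xi> $ i) * \<bar>X n t \<omega> $ i\<bar>)"
        by (intro sum_mono)
      with reach have "gap t \<le> (\<Sum>i\<in>UNIV. (u (j i) * \<xi> $ i) * \<bar>X n t \<omega> $ i\<bar>)" by (rule order_trans)
      then have "\<omega> \<in> part n (Inr j)" using \<omega> t j by (auto simp: part_def cell_def level_def)
      moreover have "Inr j \<in> parts" using j(1) unfolding parts_def cells_def by (intro InrI) (auto simp: PiE_UNIV_domain)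
      ultimately show ?thesis by blast
    qed
  qed
  have "eventually (\<lambda>n. prob (part n s) \<le> exp (- \<gamma> n * C1)) sequentially" if s: "s \<in> parts" for s
  proof (cases s)
    case (Inl i)
    have "eventually (\<lambda>n. prob (tail n i) \<le> exp (- \<gamma> n * C1)) sequentially"
      unfolding tail_def
    proof (rule A_upper[OF closed_atLeast _ R])
      fix y assume "y \<in> {R..}"
      then show "d * R powr \<theta> \<le> d * y powr \<theta>"
        using d_pos \<theta>_gt \<open>R > 0\<close> by (intro mult_left_mono powr_mono2) auto
    qed
    then show ?thesis by (simp add: Inl part_def)
  next
    case (Inr j)
    with s have j: "j i < m" for i by (auto simp: parts_def cells_def)
    have "eventually (\<lambda>n. prob {\<omega>\<in>space M. A n \<omega> $ i \<in> {l (j i)..u (j i)}}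
        \<le> exp (- \<gamma> n * (d * l (j i) powr \<theta> - e))) sequentially" for i
    proof (rule A_upper[OF closed_atLeastAtMost])
      fix y assume "y \<in> {l (j i)..u (j i)}"
      then show "d * l (j i) powr \<theta> \<le> d * y powr \<theta>"
        using d_pos \<theta>_gt lu by (intro mult_left_mono powr_mono2) auto
    qed (use \<open>e > 0\<close> in simp)
    then have "eventually (\<lambda>n. (\<Prod>i\<in>UNIV. prob {\<omega>\<in>space M. A n \<omega> $ i \<in> {l (j i)..u (j i)}})
        \<le> exp (- \<gamma> n * (\<Sum>i\<in>UNIV. d * l (j i) powr \<theta> - e))) sequentially"
      by (intro exp_upper_prod) auto
    moreover have "eventually (\<lambda>n. prob (level n j)
        \<le> exp (- \<gamma> n * (C2 - (\<Sum>i\<in>UNIV. d * u (j i) powr \<theta>)))) sequentially"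
      unfolding level_def using lu low C2 by (intro X_upper) auto
    ultimately have "eventually (\<lambda>n. prob (cell n j) \<le> exp (- \<gamma> n * C1)) sequentially"
    proof eventually_elim
      case (elim n)
      have "\<gamma> n > 0" using \<gamma> by (simp add: speed_def)
      have "prob (cell n j) \<le> exp (- \<gamma> n * (\<Sum>i\<in>UNIV. d * l (j i) powr \<theta> - e))
          * exp (- \<gamma> n * (C2 - (\<Sum>i\<in>UNIV. d * u (j i) powr \<theta>)))"
        unfolding cell_eq using elim by (intro mult_mono) auto
      also have "\<dots> = exp (- \<gamma> n * ((\<Sum>i\<in>UNIV. d * l (j i) powr \<theta> - e)
          + (C2 - (\<Sum>i\<in>UNIV. d * u (j i) powr \<theta>))))"
        by (simp add: exp_add[symmetric] algebra_simps)
      also have "\<dots> \<le> exp (- \<gamma> n * C1)"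
      proof -
        have "(\<Sum>i\<in>UNIV. d * u (j i) powr \<theta>) \<le> (\<Sum>i\<in>UNIV. (d * l (j i) powr \<theta> - e) + 2 * e)"
          using osc j by (intro sum_mono) (simp add: algebra_simps)
        also have "\<dots> = (\<Sum>i\<in>UNIV. d * l (j i) powr \<theta> - e) + P * (2 * e)"
          by (subst sum.distrib) (simp add: P_def)
        also have "P * (2 * e) = C2 - C1" using \<open>P > 0\<close> by (simp add: e_def)
        finally have "C1 \<le> (\<Sum>i\<in>UNIV. d * l (j i) powr \<theta> - e)
          + (C2 - (\<Sum>i\<in>UNIV. d * u (j i) powr \<theta>))" by simp
        then show ?thesis using \<open>\<gamma> n > 0\<close> by simp
      qed
      finally show ?case .
    qed
    then show ?thesis by (simp add: Inr part_def)
  qed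
  then have "eventually (\<lambda>n. (\<Sum>s\<in>parts. prob (part n s)) \<le> exp (- \<gamma> n * C)) sequentially"
    by (intro exp_upper_sum[OF \<gamma> \<open>finite parts\<close> C1(1)])
  then show ?thesis
  proof eventually_elim
    case (elim n)
    have "prob (exceedance n) \<le> prob (\<Union>s\<in>parts. part n s)"
      using parts_M \<open>finite parts\<close> by (intro finite_measure_mono cover sets.finite_UN) auto
    also have "\<dots> \<le> (\<Sum>s\<in>parts. prob (part n s))"
      using parts_M \<open>finite parts\<close> by (intro finite_measure_subadditive_finite) auto
    finally show ?case using elim by simp
  qed
qed

text \<open>The set of pairs of scalings and positions that exceed the level is open, so it contains a product of an
  open box around the cheap scaling with an open set around the position of the cheap path; the
  probability of this product factorises.\<close>

lemma exceedance_lower: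
  assumes t: "t \<in> {0..T}" and C: "cost t < ereal C"
  shows "eventually (\<lambda>n. exp (- \<gamma> n * C) \<le> prob (exceedance n)) sequentially"
proof -
  obtain a h where a: "\<And>i. a i \<ge> 0" and h: "h \<in> topspace (C_space T)"
    and reach: "gap t < (\<Sum>i\<in>UNIV. a i * \<xi> $ i * h t $ i)"
    and energy: "ereal (\<Sum>i\<in>UNIV. d * a i powr \<theta>) + rate h < ereal C"
    using energy_below[OF t C] by blast
  have "0 \<le> rate h"
    unfolding rate_def by (intro sum_nonneg gaussian_process.gaussian_rate_nonneg[OF gp])
  with energy obtain J where J: "rate h = ereal J" by (cases "rate h") auto
  define D where "D = (\<Sum>i\<in>UNIV. d * a i powr \<theta>)"
  \<comment> \<open>The spare cost is divided equally among the coordinates of the scaling and the path.\<close>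
  define e where "e = (C - D - J) / (real CARD('p) + 1)"
  have "D + J < C" using energy by (simp add: J D_def)
  then have "e > 0" by (simp add: e_def)
  have e: "D + real CARD('p) * e + (J + e) = C"
  proof -
    have "(real CARD('p) + 1) * e = C - D - J" by (simp add: e_def)
    then show ?thesis by (simp add: algebra_simps)
  qed
  \<comment> \<open>The optimal scaling may have vanishing components, so its neighbourhoods are taken in the whole space
    and not among positive vectors.\<close>
  define W where "W = {z :: (real^'p) \<times> (real^'p). gap t < (\<Sum>i\<in>UNIV. fst z $ i * \<xi> $ i * snd z $ i)}"
  have "open W" unfolding W_def by (intro open_Collect_less continuous_intros)
  moreover have "((\<chi> i. a i), h t) \<in> W" using reach by (simp add: W_def)
  ultimately obtain O1 O2 where O: "open O1" "open O2" "(\<chi> i. a i) \<in> O1" "h t \<in> O2" "O1 \<times> O2 \<subseteq> W"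
    by (elim open_prod_elim) auto
  obtain B where B: "\<And>i. open (B i)" "\<And>i. a i \<in> B i" "\<And>y. (\<And>i. y $ i \<in> B i) \<Longrightarrow> y \<in> O1"
  proof -
    from O(1,3) have "\<exists>B. (\<forall>i. open (B i) \<and> (\<chi> i. a i) $ i \<in> B i) \<and> (\<forall>y. (\<forall>i. y $ i \<in> B i) \<longrightarrow> y \<in> O1)"
      unfolding open_vec_def by blast
    then show thesis using that by auto
  qed
  have "eventually (\<lambda>n. exp (- \<gamma> n * (d * a i powr \<theta> + e)) \<le> prob {\<omega>\<in>space M. A n \<omega> $ i \<in> B i}) sequentially" for i
    using B a \<open>e > 0\<close> by (intro A_lower) auto
  then have "eventually (\<lambda>n. exp (- \<gamma> n * (\<Sum>i\<in>UNIV. d * a i powr \<theta> + e))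
      \<le> (\<Prod>i\<in>UNIV. prob {\<omega>\<in>space M. A n \<omega> $ i \<in> B i})) sequentially"
    by (intro exp_lower_prod) auto
  moreover have "eventually (\<lambda>n. exp (- \<gamma> n * (J + e)) \<le> prob {\<omega>\<in>space M. X n t \<omega> \<in> O2}) sequentially"
  proof -
    define G where "G = {f \<in> topspace (C_space T). f t \<in> O2}"
    have op: "openin (C_space T) G" unfolding G_def by (rule openin_C_space_evaluation[OF O(2) t])
    have "h \<in> G" using h O(4) by (simp add: G_def)
    moreover have "rate h < ereal (J + e)" using \<open>e > 0\<close> by (simp add: J)
    ultimately have "eventually (\<lambda>n. exp (- \<gamma> n * (J + e))
        \<le> prob ((\<lambda>\<omega>. \<lambda>t\<in>{0..T}. X n t \<omega>) -` G \<inter> space M)) sequentially"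
      by (intro LDP_rv_lower[OF X_LDP path_in_C_space op]) (auto simp: rate_def)
    moreover have "(\<lambda>\<omega>. \<lambda>t\<in>{0..T}. X n t \<omega>) -` G \<inter> space M = {\<omega>\<in>space M. X n t \<omega> \<in> O2}" for n
      using path_in_C_space t by (auto simp: G_def)
    ultimately show ?thesis by simp
  qed
  ultimately show ?thesis
  proof eventually_elim
    case (elim n)
    define E where "E = {\<omega>\<in>space M. X n t \<omega> \<in> O2}"
    have "E = X n t -` O2 \<inter> space (path_algebra n)" by (auto simp: E_def)
    also have "\<dots> \<in> sets (path_algebra n)"
      using X_path_measurable[OF t] O(2) by (intro measurable_sets[where A = borel]) auto
    finally have E: "E \<in> sets (path_algebra n)" .
    have "exp (- \<gamma> n * C) = exp (- \<gamma> n * (\<Sum>i\<in>UNIV. d * a i powr \<theta> + e)) * exp (- \<gamma> n * (J + e))"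
      unfolding e[symmetric] D_def exp_add[symmetric] by (simp add: sum.distrib algebra_simps)
    also have "\<dots> \<le> (\<Prod>i\<in>UNIV. prob {\<omega>\<in>space M. A n \<omega> $ i \<in> B i}) * prob E"
      using elim by (intro mult_mono) (auto simp: E_def intro!: prod_nonneg)
    also have "\<dots> = prob ({\<omega>\<in>space M. \<forall>i. A n \<omega> $ i \<in> B i} \<inter> E)"
      using B(1) E by (intro prob_box_and_independent_event[OF A_indep AX_indep, symmetric])
        (auto simp: path_algebra_def)
    also have "\<dots> \<le> prob (exceedance n)"
    proof (rule finite_measure_mono[OF _ exceedance_measurable])
      show "{\<omega>\<in>space M. \<forall>i. A n \<omega> $ i \<in> B i} \<inter> E \<subseteq> exceedance n"
      proof
        fix \<omega> assume \<omega>: "\<omega> \<in> {\<omega>\<in>space M. \<forall>i. A n \<omega> $ i \<in> B i} \<inter> E"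
        then have "(A n \<omega>, X n t \<omega>) \<in> W" using B(3) O(5) by (auto simp: E_def)
        then show "\<omega> \<in> exceedance n"
          using \<omega> t by (auto simp: exceedance_def W_def intro!: bexI[of _ t] less_imp_le)
      qed
    qed
    finally show ?case .
  qed
qed

lemma exceedance_log_asymptotics:
  "(\<lambda>n. ereal (1 / \<gamma> n) * ereal_log (prob (exceedance n))) \<longlonglongrightarrow> - w_H_perp T d \<theta> k b \<xi> x"
proof (rule log_asympI[OF \<gamma>])
  fix C assume "ereal C < w_H_perp T d \<theta> k b \<xi> x"
  then obtain w' where w': "ereal C < ereal w'" "ereal w' < w_H_perp T d \<theta> k b \<xi> x"
    by (metis ereal_dense2)
  have "ereal w' \<le> cost t" if "t \<in> {0..T}" for t
    using w'(2) w_H_perp_le_pointwise_cost[OF d_pos \<theta>_gt that, of k b \<xi> x]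
    unfolding gap_def by (meson less_imp_le order_trans)
  then show "eventually (\<lambda>n. prob (exceedance n) \<le> exp (- \<gamma> n * C)) sequentially"
    using w'(1) by (intro exceedance_upper) auto
next
  fix C assume "w_H_perp T d \<theta> k b \<xi> x < ereal C"
  from pointwise_cost_less_of_w_H_perp_less[OF d_pos \<theta>_gt this]
  obtain t where "t \<in> {0..T}" "cost t < ereal C" by (auto simp: gap_def)
  then show "eventually (\<lambda>n. exp (- \<gamma> n * C) \<le> prob (exceedance n)) sequentially"
    by (rule exceedance_lower)
qed simp

end

theorem proposition4p2:
  fixes M :: "'a measure"
    and N :: "'p::finite \<Rightarrow> 'b measure"
    and U :: "'p \<Rightarrow> real \<Rightarrow> 'b \<Rightarrow> real"
    and k :: "'p \<Rightarrow> real \<Rightarrow> real \<Rightarrow> real"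
    and X :: "nat \<Rightarrow> real \<Rightarrow> 'a \<Rightarrow> real^'p"
    and A :: "nat \<Rightarrow> 'a \<Rightarrow> real^'p"
    and Z :: "nat \<Rightarrow> real \<Rightarrow> 'a \<Rightarrow> real^'p"
    and b :: "real \<Rightarrow> real^'p"
    and \<xi> :: "real^'p"
    and \<gamma> p :: "nat \<Rightarrow> real"
    and T d \<theta> x :: real
  assumes "T > 0"
    and "prob_space M"
    and "speed \<gamma>"
    \<comment> \<open>the covariance functions \<open>k i\<close> of continuous centered Gaussian processes \<open>U i\<close>\<close>
    and "\<And>i. prob_space (N i)"
    and "\<And>i. continuous_centered_gaussian_process (N i) T (U i)"
    and "\<And>i. is_covariance_of (k i) (N i) T (U i)"
    \<comment> \<open>the processes \<open>X n\<close>\<close>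
    and "\<And>n. continuous_centered_gaussian_process M T (X n)"
    and "\<And>n \<omega>. \<omega> \<in> space M \<Longrightarrow> X n 0 \<omega> = 0"
    and "\<And>n. prob_space.indep_vars M (\<lambda>i. PiM {0..T} (\<lambda>_. borel))
               (\<lambda>i \<omega>. \<lambda>t\<in>{0..T}. X n t \<omega> $ i) UNIV"
    and "good_rate_function (C_space T)
           (\<lambda>h. \<Sum>i\<in>UNIV. gaussian_rate (N i) T (U i) (\<lambda>t\<in>{0..T}. h t $ i))"
    and "satisfies_LDP_rv (C_space T) M (\<lambda>n \<omega>. \<lambda>t\<in>{0..T}. X n t \<omega>)
           (\<lambda>h. \<Sum>i\<in>UNIV. gaussian_rate (N i) T (U i) (\<lambda>t\<in>{0..T}. h t $ i)) \<gamma>"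
    \<comment> \<open>the positive random vectors \<open>A n\<close>\<close>
    and "d > 0" and "\<theta> > 2"
    and "\<And>n. A n \<in> borel_measurable M"
    and "\<And>n i \<omega>. \<omega> \<in> space M \<Longrightarrow> A n \<omega> $ i > 0"
    and "\<And>n. prob_space.indep_vars M (\<lambda>_. borel) (\<lambda>i \<omega>. A n \<omega> $ i) UNIV"
    and "\<And>n. prob_space.indep_set M
               (sets (vimage_algebra (space M) (A n) borel))
               (sets (vimage_algebra (space M) (\<lambda>\<omega>. \<lambda>t\<in>{0..T}. X n t \<omega>)
                        (PiM {0..T} (\<lambda>_. borel))))"
    and "good_rate_function (top_of_set {0..}) (\<lambda>y::real. ereal (d * y powr \<theta>))"
    and "\<And>i. satisfies_LDP_rv (top_of_set {0..}) M (\<lambda>n \<omega>. A n \<omega> $ i)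
               (\<lambda>y::real. ereal (d * y powr \<theta>)) \<gamma>"
    \<comment> \<open>the perturbed processes and the threshold\<close>
    and "continuous_on {0..T} b"
    and "\<And>n t \<omega>. Z n t \<omega> = (\<chi> i. A n \<omega> $ i * X n t \<omega> $ i) + b t"
    and "\<xi> \<noteq> 0" and "\<And>i. \<xi> $ i \<ge> 0"
    and "x > 0" and "\<And>t. t \<in> {0..T} \<Longrightarrow> x - b t \<bullet> \<xi> > 0"
    and "\<And>n. p n = measure M {\<omega> \<in> space M. (SUP t\<in>{0..T}. Z n t \<omega> \<bullet> \<xi>) \<ge> x}"
  shows "(\<lambda>n. ereal (1 / \<gamma> n) * ereal_log (p n)) \<longlonglongrightarrow> - w_H_perp T d \<theta> k b \<xi> x"
proof -
  have "gaussian_process (N i) T (U i)" for i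
    by (intro gaussian_process.intro gaussian_process_axioms.intro assms)
  then interpret scaled_gaussian_LDP M N U k X A b \<xi> \<gamma> T d \<theta> x
    by (intro scaled_gaussian_LDP.intro scaled_gaussian_LDP_axioms.intro assms)
  have "{\<omega> \<in> space M. (SUP t\<in>{0..T}. Z n t \<omega> \<bullet> \<xi>) \<ge> x} = exceedance n" for n
    unfolding exceedance_def
  proof (intro Collect_cong conj_cong refl)
    fix \<omega> assume \<omega>: "\<omega> \<in> space M"
    have ip: "Z n t \<omega> \<bullet> \<xi> = (\<Sum>i\<in>UNIV. A n \<omega> $ i * \<xi> $ i * X n t \<omega> $ i) + b t \<bullet> \<xi>" for t
      by (simp add: assms(21) inner_add_left) (simp add: inner_vec_def algebra_simps)
    have cont: "continuous_on {0..T} (\<lambda>t. Z n t \<omega> \<bullet> \<xi>)"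
      unfolding ip by (intro continuous_intros X_continuous[OF \<omega>] b_cont)
    have "{0..T} \<noteq> {}" using \<open>T > 0\<close> by simp
    from continuous_attains_sup[OF compact_Icc this cont] obtain t0 where t0: "t0 \<in> {0..T}"
      and max: "\<And>t. t \<in> {0..T} \<Longrightarrow> Z n t \<omega> \<bullet> \<xi> \<le> Z n t0 \<omega> \<bullet> \<xi>" by blast
    have "(SUP t\<in>{0..T}. Z n t \<omega> \<bullet> \<xi>) = Z n t0 \<omega> \<bullet> \<xi>"
      using t0 max by (intro cSup_eq_maximum) auto
    then have "x \<le> (SUP t\<in>{0..T}. Z n t \<omega> \<bullet> \<xi>) \<longleftrightarrow> (\<exists>t\<in>{0..T}. x \<le> Z n t \<omega> \<bullet> \<xi>)"
      using t0 max by (metis order_trans)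
    also have "\<dots> \<longleftrightarrow> (\<exists>t\<in>{0..T}. gap t \<le> (\<Sum>i\<in>UNIV. A n \<omega> $ i * \<xi> $ i * X n t \<omega> $ i))"
      by (intro bex_cong refl) (auto simp: ip gap_def)
    finally show "x \<le> (SUP t\<in>{0..T}. Z n t \<omega> \<bullet> \<xi>) \<longleftrightarrow>
      (\<exists>t\<in>{0..T}. gap t \<le> (\<Sum>i\<in>UNIV. A n \<omega> $ i * \<xi> $ i * X n t \<omega> $ i))" .
  qed
  then have "p n = prob (exceedance n)" for n by (simp add: assms(26))
  then show ?thesis using exceedance_log_asymptotics by simp
qed

end
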